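(* Let $r$ be a positive integer. There are only finitely many (up to isomorphism) excluded minors of rank $r$ for the class of lifted-graphic matroids.
   Context: All matroids are finite. A matroid $M$ is lifted-graphic if there is a matroid $N$ with $E(N)=E(M)\cup\{e\}$ (where $e\notin E(M)$) such that $N\backslash e=M$ and $N/e$ is graphic. The class of lifted-graphic matroids is minor-closed. An excluded minor for a minor-closed class is a matroid that is not in the class but all of whose proper minors are in the class. *)

theory Defs
  imports "HOL-Library.Infinite_Typeclass"
begin

section \<open>Finite matroids\<close>

text \<open>
  A matroid is a pair of a ground set and a family of independent sets. Two matroids are equal as
  records iff they have the same ground set and the same independent sets, so an equation such as
  \<open>N \ e = M\<close> is a genuine equality of matroids.
\<close>

record 'a matroid =
  ground :: "'a set"
  indep :: "'a set set"

locale matroid =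
  fixes M :: "'a matroid"
  assumes finite_ground: "finite (ground M)"
    and indep_subset_ground: "X \<in> indep M \<Longrightarrow> X \<subseteq> ground M"
    and indep_empty: "{} \<in> indep M"
    and indep_mono: "Y \<in> indep M \<Longrightarrow> X \<subseteq> Y \<Longrightarrow> X \<in> indep M"
    and augmentation: "X \<in> indep M \<Longrightarrow> Y \<in> indep M \<Longrightarrow> card X < card Y \<Longrightarrow>
                         \<exists>y \<in> Y - X. insert y X \<in> indep M"

definition matroid_rank :: "'a matroid \<Rightarrow> nat" where
  "matroid_rank M = Max (card ` indep M)"

definition basis_of :: "'a matroid \<Rightarrow> 'a set \<Rightarrow> 'a set \<Rightarrow> bool" where
  "basis_of M X B \<longleftrightarrow>
     B \<in> indep M \<and> B \<subseteq> X \<and> (\<forall>B' \<in> indep M. B \<subseteq> B' \<and> B' \<subseteq> X \<longrightarrow> B' = B)"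

definition isomorphic :: "'a matroid \<Rightarrow> 'b matroid \<Rightarrow> bool" where
  "isomorphic M N \<longleftrightarrow>
     (\<exists>f. bij_betw f (ground M) (ground N) \<and>
          (\<forall>X \<subseteq> ground M. X \<in> indep M \<longleftrightarrow> f ` X \<in> indep N))"

definition matroid_iso_rel :: "('a matroid \<times> 'a matroid) set" where
  "matroid_iso_rel = {(M, N). matroid M \<and> matroid N \<and> isomorphic M N}"

lemma isomorphic_refl: "isomorphic M M"
  unfolding isomorphic_def by (rule exI[of _ id]) auto

lemma isomorphic_sym:
  assumes "isomorphic M N"
  shows "isomorphic N M"
proof -
  obtain f where f: "bij_betw f (ground M) (ground N)"
    and I: "\<And>X. X \<subseteq> ground M \<Longrightarrow> X \<in> indep M \<longleftrightarrow> f ` X \<in> indep N"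
    using assms unfolding isomorphic_def by blast
  let ?g = "inv_into (ground M) f"
  have g: "bij_betw ?g (ground N) (ground M)"
    using f by (rule bij_betw_inv_into)
  have "Y \<in> indep N \<longleftrightarrow> ?g ` Y \<in> indep M" if "Y \<subseteq> ground N" for Y
  proof -
    have "f ` (?g ` Y) = Y"
      using f that by (simp add: bij_betw_def image_inv_into_cancel)
    moreover have "?g ` Y \<subseteq> ground M"
      using g that by (auto simp: bij_betw_def)
    ultimately show ?thesis
      using I by metis
  qed
  with g show ?thesis
    unfolding isomorphic_def by blast
qed

lemma isomorphic_trans:
  assumes "isomorphic M N" "isomorphic N K"
  shows "isomorphic M K"
proof -
  obtain f where f: "bij_betw f (ground M) (ground N)"
    and I: "\<And>X. X \<subseteq> ground M \<Longrightarrow> X \<in> indep M \<longleftrightarrow> f ` X \<in> indep N"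
    using assms(1) unfolding isomorphic_def by blast
  obtain g where g: "bij_betw g (ground N) (ground K)"
    and J: "\<And>X. X \<subseteq> ground N \<Longrightarrow> X \<in> indep N \<longleftrightarrow> g ` X \<in> indep K"
    using assms(2) unfolding isomorphic_def by blast
  have "X \<in> indep M \<longleftrightarrow> (g \<circ> f) ` X \<in> indep K" if "X \<subseteq> ground M" for X
  proof -
    have "f ` X \<subseteq> ground N"
      using f that by (auto simp: bij_betw_def)
    then show ?thesis
      using I[OF that] J by (simp add: image_comp)
  qed
  with bij_betw_trans[OF f g] show ?thesis
    unfolding isomorphic_def by blast
qed

lemma equiv_matroid_iso_rel: "equiv {M. matroid M} matroid_iso_rel"
  by (rule equivI)
    (auto simp: matroid_iso_rel_def refl_on_def
       intro!: symI transI intro: isomorphic_refl isomorphic_sym isomorphic_trans)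


section \<open>Minors\<close>

definition delete :: "'a matroid \<Rightarrow> 'a set \<Rightarrow> 'a matroid" where
  "delete M D = \<lparr>ground = ground M - D, indep = {X \<in> indep M. X \<subseteq> ground M - D}\<rparr>"

definition contract :: "'a matroid \<Rightarrow> 'a set \<Rightarrow> 'a matroid" where
  "contract M C =
     \<lparr>ground = ground M - C,
      indep = {X. X \<subseteq> ground M - C \<and> (\<exists>B. basis_of M C B \<and> X \<union> B \<in> indep M)}\<rparr>"

definition is_minor :: "'a matroid \<Rightarrow> 'a matroid \<Rightarrow> bool" where
  "is_minor N M \<longleftrightarrow>
     (\<exists>C D. C \<subseteq> ground M \<and> D \<subseteq> ground M \<and> C \<inter> D = {} \<and> N = delete (contract M C) D)"

definition proper_minor :: "'a matroid \<Rightarrow> 'a matroid \<Rightarrow> bool" where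
  "proper_minor N M \<longleftrightarrow> is_minor N M \<and> N \<noteq> M"

definition excluded_minor :: "('a matroid \<Rightarrow> bool) \<Rightarrow> 'a matroid \<Rightarrow> bool" where
  "excluded_minor \<C> M \<longleftrightarrow> matroid M \<and> \<not> \<C> M \<and> (\<forall>N. proper_minor N M \<longrightarrow> \<C> N)"


section \<open>Graphic and lifted-graphic matroids\<close>

text \<open>
  Graphs are finite and undirected, and may have loops (one end) and parallel edges.
\<close>

record ('v, 'e) multigraph =
  verts :: "'v set"
  edges :: "'e set"
  ends :: "'e \<Rightarrow> 'v set"

locale multigraph =
  fixes G :: "('v, 'e) multigraph"
  assumes finite_verts: "finite (verts G)"
    and finite_edges: "finite (edges G)"
    and ends_subset_verts: "e \<in> edges G \<Longrightarrow> ends G e \<subseteq> verts G"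
    and card_ends: "e \<in> edges G \<Longrightarrow> card (ends G e) = 1 \<or> card (ends G e) = 2"

text \<open>
  The cycle with vertices \<open>vs\<close> and edges \<open>es\<close> in cyclic order. A cycle of length 1 is a loop. A cycle
  of length 2 is a pair of parallel edges, which is why distinctness of \<open>es\<close> has to be required.
\<close>

definition cycle_edge_set :: "('v, 'e) multigraph \<Rightarrow> 'e set \<Rightarrow> bool" where
  "cycle_edge_set G C \<longleftrightarrow>
     (\<exists>vs es. es \<noteq> [] \<and> length vs = length es \<and> distinct vs \<and> distinct es \<and>
        set es = C \<and> C \<subseteq> edges G \<and>
        (\<forall>i < length es. ends G (es ! i) = {vs ! i, vs ! (Suc i mod length es)}))"

definition cycle_matroid :: "('v, 'e) multigraph \<Rightarrow> 'e matroid" where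
  "cycle_matroid G =
     \<lparr>ground = edges G, indep = {F. F \<subseteq> edges G \<and> \<not> (\<exists>C \<subseteq> F. cycle_edge_set G C)}\<rparr>"

text \<open>
  Since graphs are finite, restricting vertices to natural numbers loses no generality.
\<close>

definition graphic :: "'a matroid \<Rightarrow> bool" where
  "graphic M \<longleftrightarrow>
     matroid M \<and>
     (\<exists>G :: (nat, 'a) multigraph. multigraph G \<and> isomorphic M (cycle_matroid G))"

text \<open>
  The element type is required to be infinite so that an element \<open>e\<close> outside the (finite) ground
  set is always available.
\<close>

definition lifted_graphic :: "'a::infinite matroid \<Rightarrow> bool" where
  "lifted_graphic M \<longleftrightarrow>
     matroid M \<and>
     (\<exists>N e. matroid N \<and> e \<notin> ground M \<and> ground N = insert e (ground M) \<and>
        delete N {e} = M \<and> graphic (contract N {e}))"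

end

theory Submission
  imports Defs
begin

text \<open>
  A matroid is lifted-graphic iff it has a graphic elementary quotient, and a graphic matroid of rank
  at most \<open>r\<close> has boundedly many parallel classes. So a large excluded minor \<open>M\<close> of rank \<open>r\<close>, which
  has no parallel pairs and at most one loop, contains a long line \<open>L\<close>, and for each \<open>f\<close> in \<open>L\<close> the
  set \<open>L - f\<close> has rank 1 in a graphic quotient \<open>K\<^sub>f\<close> of \<open>M \ f\<close>. As \<open>M\<close> is not lifted-graphic, adding
  \<open>f\<close> to \<open>K\<^sub>f\<close> in parallel with \<open>L - f\<close> does not give a quotient of \<open>M\<close>. Hence \<open>f\<close> is spanned in \<open>M\<close>
  by a set \<open>X\<^sub>f\<close> whose closure in \<open>K\<^sub>f\<close> contains no nonloop of \<open>L - f\<close>. Up to exchanging elements of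
  common long lines there are boundedly many sets \<open>X\<^sub>f\<close>. If \<open>X\<^sub>e\<close> and \<open>X\<^sub>f\<close> agree in this sense, then
  they have the same closure in \<open>K\<^sub>f\<close>, so it contains \<open>e\<close>, and \<open>e\<close> can be chosen to be a nonloop of
  \<open>K\<^sub>f\<close>, a contradiction.
\<close>

section \<open>Rank and closure\<close>

text \<open>Arbitrary sets are allowed: elements outside the ground set never raise the rank, so
  most rank facts need no side condition. Only closures are cut down to the ground set.\<close>

definition rk :: "'a matroid \<Rightarrow> 'a set \<Rightarrow> nat" where
  "rk M X = Max (card ` {I \<in> indep M. I \<subseteq> X})"

definition cl :: "'a matroid \<Rightarrow> 'a set \<Rightarrow> 'a set" where
  "cl M X = {x \<in> ground M. rk M (insert x X) = rk M X}"

lemma cl_subset_ground: "cl M X \<subseteq> ground M"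
  by (auto simp: cl_def)

context matroid
begin

lemma finite_indep: "I \<in> indep M \<Longrightarrow> finite I"
  using indep_subset_ground finite_ground finite_subset by metis

lemma finite_indep_family: "finite (indep M)"
  by (rule finite_subset[of _ "Pow (ground M)"])
    (auto simp: finite_ground dest: indep_subset_ground)

lemma card_le_rk: "I \<in> indep M \<Longrightarrow> I \<subseteq> X \<Longrightarrow> card I \<le> rk M X"
  unfolding rk_def using finite_indep_family by (intro Max_ge) auto

lemma rk_attained:
  obtains I where "I \<in> indep M" "I \<subseteq> X" "card I = rk M X"
proof -
  have "rk M X \<in> card ` {I \<in> indep M. I \<subseteq> X}"
    unfolding rk_def using finite_indep_family indep_empty by (intro Max_in) auto
  then show thesis using that by auto
qed

lemma extend_to_rk:
  assumes "I \<in> indep M" "I \<subseteq> X"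
  obtains B where "B \<in> indep M" "I \<subseteq> B" "B \<subseteq> X" "card B = rk M X"
proof -
  have "\<exists>B \<in> indep M. I \<subseteq> B \<and> B \<subseteq> X \<and> card B = rk M X"
    using assms
  proof (induction "rk M X - card I" arbitrary: I)
    case 0
    then have "card I = rk M X" using card_le_rk[of I X] by simp
    then show ?case using "0.prems" by blast
  next
    case (Suc n)
    obtain J where J: "J \<in> indep M" "J \<subseteq> X" "card J = rk M X"
      using rk_attained .
    moreover have "card I < card J" using Suc.hyps(2) J by linarith
    ultimately obtain y where y: "y \<in> J - I" "insert y I \<in> indep M"
      using augmentation[of I J] Suc.prems by blast
    have "card (insert y I) = Suc (card I)"
      using y finite_indep[OF Suc.prems(1)] by simp
    then have "n = rk M X - card (insert y I)" "insert y I \<subseteq> X"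
      using Suc.hyps(2) Suc.prems y J by auto
    from Suc.hyps(1)[OF this(1) y(2) this(2)] show ?case by blast
  qed
  then show thesis using that by blast
qed

lemma rk_mono: "X \<subseteq> Y \<Longrightarrow> rk M X \<le> rk M Y"
  by (metis rk_attained card_le_rk order_trans)

lemma rk_indep: "I \<in> indep M \<Longrightarrow> rk M I = card I"
  by (metis card_le_rk card_mono finite_indep le_antisym rk_attained subset_refl)

lemma indep_iff_rk: "finite X \<Longrightarrow> X \<in> indep M \<longleftrightarrow> rk M X = card X"
  by (metis card_subset_eq rk_attained rk_indep)

lemma rk_le_card: "finite X \<Longrightarrow> rk M X \<le> card X"
  by (metis card_mono rk_attained)

lemma rk_insert_le: "rk M (insert x X) \<le> Suc (rk M X)"
proof -
  obtain I where I: "I \<in> indep M" "I \<subseteq> insert x X" "card I = rk M (insert x X)"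
    using rk_attained .
  have "card (I - {x}) \<le> rk M X"
    using I by (intro card_le_rk) (auto intro: indep_mono)
  moreover have "card I \<le> Suc (card (I - {x}))"
    using finite_indep[OF I(1)] by (metis card_Suc_Diff1 Diff_empty Diff_insert0 le_Suc_eq order_refl)
  ultimately show ?thesis using I by linarith
qed

text \<open>Submodularity in the form used throughout: gains of rank shrink as the set grows. Extend
  a basis \<open>B\<close> of \<open>X\<close> to \<open>Y\<close> and then to
  \<open>insert x Y\<close>; if the last step gained rank, it would use \<open>x\<close>, and
  \<open>insert x B\<close> would be independent in \<open>insert x X\<close>.\<close>

lemma rk_insert_eq_mono:
  assumes "X \<subseteq> Y" "rk M (insert x X) = rk M X"
  shows "rk M (insert x Y) = rk M Y"
proof (rule ccontr)
  assume "rk M (insert x Y) \<noteq> rk M Y"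
  then have gt: "rk M Y < rk M (insert x Y)"
    using rk_mono[OF subset_insertI] by (simp add: le_neq_implies_less)
  obtain B where B: "B \<in> indep M" "B \<subseteq> X" "card B = rk M X"
    using rk_attained .
  obtain C where C: "C \<in> indep M" "B \<subseteq> C" "C \<subseteq> Y" "card C = rk M Y"
    using extend_to_rk[of B Y] B assms(1) by blast
  obtain D where D: "D \<in> indep M" "C \<subseteq> D" "D \<subseteq> insert x Y" "card D = rk M (insert x Y)"
    using extend_to_rk[of C "insert x Y"] C by blast
  have "x \<in> D" and "x \<notin> Y"
    using card_le_rk[of D Y] D gt by (auto simp: insert_absorb)
  then have "insert x B \<in> indep M" "card (insert x B) = Suc (card B)"
    using B C D assms(1) finite_indep[OF B(1)] indep_mono[of D "insert x B"]
    by (blast, subst card_insert_disjoint) auto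
  then show False
    using card_le_rk[of "insert x B" "insert x X"] B assms(2) by auto
qed

lemma cl_mono: "X \<subseteq> Y \<Longrightarrow> cl M X \<subseteq> cl M Y"
  by (auto simp: cl_def intro: rk_insert_eq_mono)

lemma subset_cl: "X \<subseteq> ground M \<Longrightarrow> X \<subseteq> cl M X"
  by (auto simp: cl_def insert_absorb)

lemma rk_Un_subset_cl:
  assumes "Y \<subseteq> cl M X"
  shows "rk M (X \<union> Y) = rk M X"
proof -
  have "finite Y"
    using finite_subset[OF assms] finite_subset[OF cl_subset_ground finite_ground] by blast
  then show ?thesis
    using assms
  proof (induction Y)
    case (insert y Y)
    then have "rk M (insert y X) = rk M X" and IH: "rk M (X \<union> Y) = rk M X"
      by (auto simp: cl_def)
    then have "rk M (insert y (X \<union> Y)) = rk M (X \<union> Y)"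
      using rk_insert_eq_mono[of X "X \<union> Y" y] by blast
    then show ?case using IH by simp
  qed simp
qed

lemma rk_cl: "X \<subseteq> ground M \<Longrightarrow> rk M (cl M X) = rk M X"
  using rk_Un_subset_cl[of "cl M X" X] subset_cl[of X] by (simp add: Un_absorb1)

lemma cl_subset_cl:
  assumes "Y \<subseteq> cl M X"
  shows "cl M Y \<subseteq> cl M X"
proof
  fix x assume x: "x \<in> cl M Y"
  then have "rk M (insert x (X \<union> Y)) = rk M (X \<union> Y)"
    using rk_insert_eq_mono[of Y "X \<union> Y" x] by (simp add: cl_def)
  then have "rk M (insert x X) \<le> rk M X"
    using rk_Un_subset_cl[OF assms] rk_mono[of "insert x X" "insert x (X \<union> Y)"] by auto
  then show "x \<in> cl M X"
    using x rk_mono[OF subset_insertI, of X x] by (simp add: cl_def)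
qed

lemma subset_cl_if_rk_le:
  assumes "A \<subseteq> X" "X \<subseteq> ground M" "rk M X \<le> rk M A"
  shows "X \<subseteq> cl M A"
proof
  fix x assume "x \<in> X"
  then have "rk M (insert x A) \<le> rk M A" "rk M A \<le> rk M (insert x A)"
    using assms rk_mono[of "insert x A" X] rk_mono[of A "insert x A"] by auto
  then show "x \<in> cl M A"
    using assms \<open>x \<in> X\<close> by (auto simp: cl_def)
qed

end

lemma matroid_rank_eq_rk:
  assumes "matroid M"
  shows "matroid_rank M = rk M (ground M)"
proof -
  have "{I \<in> indep M. I \<subseteq> ground M} = indep M"
    using matroid.indep_subset_ground[OF assms] by blast
  then show ?thesis by (simp add: matroid_rank_def rk_def)
qed

lemma ground_delete [simp]: "ground (delete M D) = ground M - D"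
  by (simp add: delete_def)

lemma rk_delete: "X \<subseteq> ground M - D \<Longrightarrow> rk (delete M D) X = rk M X"
  unfolding rk_def delete_def by (rule arg_cong[of _ _ "\<lambda>S. Max (card ` S)"]) auto

lemma cl_delete: "X \<subseteq> ground M - D \<Longrightarrow> cl (delete M D) X = cl M X - D"
  unfolding cl_def by (auto simp: rk_delete)


section \<open>Inverse images of matroids\<close>

text \<open>Elements with a common image become parallel, or loops if that image is a loop. The
  construction serves both to add an element in parallel and to relabel a matroid along a
  bijection.\<close>

definition inverse_image :: "('b \<Rightarrow> 'a) \<Rightarrow> 'b set \<Rightarrow> 'a matroid \<Rightarrow> 'b matroid" where
  "inverse_image \<phi> E K =
     \<lparr>ground = E, indep = {F. F \<subseteq> E \<and> inj_on \<phi> F \<and> \<phi> ` F \<in> indep K}\<rparr>"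

lemma ground_inverse_image [simp]: "ground (inverse_image \<phi> E K) = E"
  by (simp add: inverse_image_def)

lemma matroid_inverse_image:
  assumes "matroid K" "finite E"
  shows "matroid (inverse_image \<phi> E K)"
proof -
  interpret K: matroid K by fact
  show ?thesis
  proof
    fix X Y
    assume X: "X \<in> indep (inverse_image \<phi> E K)" and Y: "Y \<in> indep (inverse_image \<phi> E K)"
      and less: "card X < card Y"
    have "card (\<phi> ` X) < card (\<phi> ` Y)"
      using X Y less by (simp add: inverse_image_def card_image)
    then obtain y where y: "y \<in> Y" "\<phi> y \<notin> \<phi> ` X" "insert (\<phi> y) (\<phi> ` X) \<in> indep K"
      using K.augmentation[of "\<phi> ` X" "\<phi> ` Y"] X Y by (auto simp: inverse_image_def)
    then have "insert y X \<in> indep (inverse_image \<phi> E K)"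
      using X Y by (auto simp: inverse_image_def)
    then show "\<exists>y \<in> Y - X. insert y X \<in> indep (inverse_image \<phi> E K)"
      using y by blast
  next
    fix X Y
    assume "Y \<in> indep (inverse_image \<phi> E K)" "X \<subseteq> Y"
    then show "X \<in> indep (inverse_image \<phi> E K)"
      using K.indep_mono[of "\<phi> ` Y" "\<phi> ` X"]
      by (auto simp: inverse_image_def intro: inj_on_subset)
  qed (use assms K.indep_empty in \<open>auto simp: inverse_image_def\<close>)
qed

lemma rk_inverse_image:
  assumes "matroid K" "finite E" "X \<subseteq> E"
  shows "rk (inverse_image \<phi> E K) X = rk K (\<phi> ` X)"
proof (rule antisym)
  interpret K: matroid K by fact
  interpret I: matroid "inverse_image \<phi> E K"
    using assms by (simp add: matroid_inverse_image)
  obtain F where "F \<in> indep (inverse_image \<phi> E K)" "F \<subseteq> X" "card F = rk (inverse_image \<phi> E K) X"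
    using I.rk_attained .
  then show "rk (inverse_image \<phi> E K) X \<le> rk K (\<phi> ` X)"
    using K.card_le_rk[of "\<phi> ` F" "\<phi> ` X"]
    by (auto simp: inverse_image_def card_image image_mono)
  obtain J where J: "J \<in> indep K" "J \<subseteq> \<phi> ` X" "card J = rk K (\<phi> ` X)"
    using K.rk_attained .
  then obtain F where "F \<subseteq> X" "inj_on \<phi> F" "J = \<phi> ` F"
    by (auto simp: subset_image_inj)
  then show "rk K (\<phi> ` X) \<le> rk (inverse_image \<phi> E K) X"
    using I.card_le_rk[of F X] J assms by (auto simp: inverse_image_def card_image)
qed


section \<open>Graphic matroids\<close>

lemma cycle_edge_set_image:
  assumes C: "cycle_edge_set G C" and inj: "inj_on \<psi> C" and sub: "\<psi> ` C \<subseteq> edges H"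
    and ends: "\<And>x. x \<in> C \<Longrightarrow> ends H (\<psi> x) = ends G x"
  shows "cycle_edge_set H (\<psi> ` C)"
proof -
  obtain vs es where "es \<noteq> []" "length vs = length es" "distinct vs" "distinct es" "set es = C"
      "\<And>i. i < length es \<Longrightarrow> ends G (es ! i) = {vs ! i, vs ! (Suc i mod length es)}"
    using C unfolding cycle_edge_set_def by blast
  then show ?thesis
    unfolding cycle_edge_set_def using inj sub ends
    by (intro exI[of _ vs] exI[of _ "map \<psi> es"]) (auto simp: distinct_map)
qed

lemma cycle_edge_set_loop:
  assumes "x \<in> edges G" "ends G x = {v}"
  shows "cycle_edge_set G {x}"
  unfolding cycle_edge_set_def using assms by (intro exI[of _ "[v]"] exI[of _ "[x]"]) auto

lemma cycle_edge_set_digon: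
  assumes "x \<in> edges G" "y \<in> edges G" "x \<noteq> y" "ends G x = ends G y" "card (ends G x) = 2"
  shows "cycle_edge_set G {x, y}"
proof -
  obtain u v where "ends G x = {u, v}" "u \<noteq> v"
    using assms(5) by (meson card_2_iff)
  then show ?thesis
    unfolding cycle_edge_set_def using assms
    by (intro exI[of _ "[u, v]"] exI[of _ "[x, y]"]) (auto simp: less_Suc_eq)
qed

text \<open>Each end of \<open>x\<close> is shared with the preceding or the following edge of the
  cycle. Two distinct ends rule out a loop, so both of these edges differ from
  \<open>x\<close>.\<close>

lemma cycle_edge_set_ends_covered:
  assumes C: "cycle_edge_set G C" and x: "x \<in> C" and "card (ends G x) = 2"
  shows "ends G x \<subseteq> (\<Union>y \<in> C - {x}. ends G y)"
proof -
  obtain vs es where es: "length vs = length es" "distinct es" "set es = C"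
      "\<And>i. i < length es \<Longrightarrow> ends G (es ! i) = {vs ! i, vs ! (Suc i mod length es)}"
    using C unfolding cycle_edge_set_def by blast
  let ?n = "length es"
  obtain i where i: "i < ?n" "es ! i = x"
    using x es(3) by (metis in_set_conv_nth)
  have n: "?n \<ge> 2"
  proof (rule ccontr)
    assume "\<not> ?n \<ge> 2"
    then have "i = 0" "?n = 1" using i by auto
    then show False using es(4)[OF i(1)] i assms(3) by simp
  qed
  have *: "es ! j \<in> C - {x}" if "j < ?n" "j \<noteq> i" for j
    using that i es by (auto simp: nth_eq_iff_index_eq)
  \<comment> \<open>\<open>p\<close> and \<open>s\<close> are the cyclic positions before and after
    \<open>i\<close>; they coincide in a cycle of length 2.\<close>
  define p where "p = (if i = 0 then ?n - 1 else i - 1)"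
  have p: "p < ?n" "p \<noteq> i" "Suc p mod ?n = i"
    using i n by (auto simp: p_def)
  define s where "s = Suc i mod ?n"
  have s: "s < ?n" "s \<noteq> i"
    using i n by (auto simp: s_def mod_Suc split: if_splits)
  have "vs ! i \<in> ends G (es ! p)" "vs ! s \<in> ends G (es ! s)"
    using es(4)[OF p(1)] es(4)[OF s(1)] p by auto
  moreover have "ends G x = {vs ! i, vs ! s}"
    using es(4)[OF i(1)] i by (simp add: s_def)
  ultimately show ?thesis
    using *[OF p(1,2)] *[OF s] by auto
qed

text \<open>Give each \<open>x\<close> in \<open>E\<close> the ends of the edge representing
  \<open>\<phi> x\<close>: copies of an element become parallel edges, or loops at one
  vertex.\<close>

lemma graphic_inverse_image:
  fixes K :: "'a matroid"
  assumes K: "graphic K" and E: "finite E" "\<phi> ` E \<subseteq> ground K"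
  shows "graphic (inverse_image \<phi> E K :: 'a matroid)"
proof -
  obtain G :: "(nat, 'a) multigraph" and f
    where G: "multigraph G" and f: "bij_betw f (ground K) (edges G)"
      and ind: "\<And>X. X \<subseteq> ground K \<Longrightarrow> X \<in> indep K \<longleftrightarrow> f ` X \<in> indep (cycle_matroid G)"
    using K by (auto simp: graphic_def isomorphic_def cycle_matroid_def)
  interpret G: multigraph G by fact
  define \<psi> where "\<psi> = f \<circ> \<phi>"
  define H :: "(nat, 'a) multigraph"
    where "H = \<lparr>verts = verts G, edges = E, ends = \<lambda>x. ends G (\<psi> x)\<rparr>"
  have [simp]: "edges H = E" "ends H x = ends G (\<psi> x)" for x
    by (simp_all add: H_def)
  have \<psi>: "\<psi> ` E \<subseteq> edges G"
    using E f by (auto simp: \<psi>_def bij_betw_def)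
  have H: "multigraph H"
  proof
    fix e assume "e \<in> edges H"
    then have "\<psi> e \<in> edges G" using \<psi> by auto
    then show "ends H e \<subseteq> verts H" "card (ends H e) = 1 \<or> card (ends H e) = 2"
      using G.ends_subset_verts G.card_ends by (auto simp: H_def)
  qed (auto simp: H_def E G.finite_verts)
  have iff: "inj_on \<phi> F \<and> \<phi> ` F \<in> indep K \<longleftrightarrow> \<not> (\<exists>C \<subseteq> F. cycle_edge_set H C)"
    if F: "F \<subseteq> E" for F
  proof -
    have "\<phi> ` F \<subseteq> ground K" using F E by auto
    then have "\<phi> ` F \<in> indep K \<longleftrightarrow> \<not> (\<exists>C \<subseteq> \<psi> ` F. cycle_edge_set G C)"
      using ind[of "\<phi> ` F"] \<psi> F by (auto simp: cycle_matroid_def \<psi>_def image_comp)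
    moreover have "inj_on \<phi> F \<longleftrightarrow> inj_on \<psi> F"
      using \<open>\<phi> ` F \<subseteq> ground K\<close> f unfolding \<psi>_def bij_betw_def
      by (meson comp_inj_on inj_on_imageI2 inj_on_subset)
    \<comment> \<open>Two elements of \<open>F\<close> with the same image would yield a loop or a
      digon of \<open>H\<close>.\<close>
    moreover have "inj_on \<psi> F" if no: "\<not> (\<exists>C \<subseteq> F. cycle_edge_set H C)"
    proof (rule inj_onI, rule ccontr)
      have acyclic: "\<not> cycle_edge_set H C" if "C \<subseteq> F" for C using no that by blast
      fix x y assume xy: "x \<in> F" "y \<in> F" "\<psi> x = \<psi> y" "x \<noteq> y"
      have "card (ends G (\<psi> x)) = 1 \<or> card (ends G (\<psi> x)) = 2"
        using G.card_ends[of "\<psi> x"] \<psi> xy F by auto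
      then show False
      proof
        assume "card (ends G (\<psi> x)) = 1"
        then obtain v where "ends H x = {v}" by (auto simp: card_1_singleton_iff)
        then have "cycle_edge_set H {x}" using xy F by (intro cycle_edge_set_loop) auto
        then show False using acyclic[of "{x}"] xy by simp
      next
        assume "card (ends G (\<psi> x)) = 2"
        then have "cycle_edge_set H {x, y}" using xy F by (intro cycle_edge_set_digon) auto
        then show False using acyclic[of "{x, y}"] xy by simp
      qed
    qed
    moreover have "(\<exists>C \<subseteq> F. cycle_edge_set H C) \<longleftrightarrow> (\<exists>C \<subseteq> \<psi> ` F. cycle_edge_set G C)"
      if inj: "inj_on \<psi> F"
    proof
      assume "\<exists>C \<subseteq> F. cycle_edge_set H C"
      then obtain C where C: "C \<subseteq> F" "cycle_edge_set H C" by blast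
      moreover have "\<psi> ` C \<subseteq> edges G" using C F \<psi> by blast
      ultimately have "cycle_edge_set G (\<psi> ` C)"
        using inj_on_subset[OF inj C(1)] by (intro cycle_edge_set_image[OF C(2)]) auto
      then show "\<exists>C \<subseteq> \<psi> ` F. cycle_edge_set G C"
        using C(1) by (intro exI[of _ "\<psi> ` C"]) (simp add: image_mono)
    next
      assume "\<exists>C \<subseteq> \<psi> ` F. cycle_edge_set G C"
      then obtain C where C: "C \<subseteq> \<psi> ` F" "cycle_edge_set G C" by blast
      have "inv_into F \<psi> x \<in> F" if "x \<in> C" for x
        using that C(1) by (auto intro: inv_into_into)
      then have sub: "inv_into F \<psi> ` C \<subseteq> F" by blast
      have "ends H (inv_into F \<psi> x) = ends G x" if "x \<in> C" for x
        using that C(1) by (simp add: f_inv_into_f subset_iff)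
      then have "cycle_edge_set H (inv_into F \<psi> ` C)"
        using sub F inj_on_inv_into[OF C(1)]
        by (intro cycle_edge_set_image[OF C(2)]) auto
      then show "\<exists>C \<subseteq> F. cycle_edge_set H C" using sub by blast
    qed
    ultimately show ?thesis by blast
  qed
  have "inverse_image \<phi> E K = cycle_matroid H"
    using iff by (auto simp: inverse_image_def cycle_matroid_def)
  moreover have "matroid (inverse_image \<phi> E K)"
    using K E by (simp add: graphic_def matroid_inverse_image)
  ultimately show ?thesis
    unfolding graphic_def using H isomorphic_refl by metis
qed

text \<open>A basis of rank \<open>r\<close> covers at most \<open>2 r\<close> vertices, and every edge has its ends among them.\<close>

lemma card_graphic_simple_le:
  assumes K: "graphic K" and Q: "Q \<subseteq> ground K"
    and simple: "\<And>x y. x \<in> Q \<Longrightarrow> y \<in> Q \<Longrightarrow> x \<noteq> y \<Longrightarrow> rk K {x, y} = 2"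
  shows "card Q \<le> 2 ^ (2 * rk K (ground K))"
\<comment> \<open>If \<open>Q\<close> has a single element, that may be a loop, as
  \<open>simple\<close> says nothing about it. With two or more elements, each lies in an
  independent pair.\<close>
proof (cases "card Q \<le> 1")
  case True
  then show ?thesis by (meson one_le_numeral one_le_power order_trans)
next
  case False
  interpret matroid K using K by (simp add: graphic_def)
  obtain G :: "(nat, 'a) multigraph" and f
    where G: "multigraph G" and f: "bij_betw f (ground K) (edges G)"
      and ind: "\<And>X. X \<subseteq> ground K \<Longrightarrow> X \<in> indep K \<longleftrightarrow> f ` X \<in> indep (cycle_matroid G)"
    using K by (auto simp: graphic_def isomorphic_def cycle_matroid_def)
  interpret G: multigraph G by fact
  have fE: "f x \<in> edges G" if "x \<in> ground K" for x
    using f that by (auto simp: bij_betw_def)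
  have finQ: "finite Q" using Q finite_ground finite_subset by blast
  have acyclic: "\<not> cycle_edge_set G (f ` C)" if "C \<subseteq> X" "X \<in> indep K" for C X
    using that ind[of X] indep_subset_ground[of X] image_mono[OF that(1), of f]
    by (auto simp: cycle_matroid_def)
  have pair: "{x, y} \<in> indep K" if "x \<in> Q" "y \<in> Q" "x \<noteq> y" for x y
    using that simple[OF that] by (simp add: indep_iff_rk)
  have two: "card (ends G (f x)) = 2" if x: "x \<in> Q" for x
  proof (rule ccontr)
    assume "card (ends G (f x)) \<noteq> 2"
    then obtain v where "ends G (f x) = {v}"
      using G.card_ends[of "f x"] fE x Q by (auto simp: card_1_singleton_iff)
    then have "cycle_edge_set G (f ` {x})"
      using fE x Q by (auto intro: cycle_edge_set_loop)
    moreover obtain y where "y \<in> Q" "y \<noteq> x"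
      using False finQ card_le_Suc0_iff_eq x by (metis One_nat_def)
    ultimately show False using acyclic[of "{x}" "{x, y}"] pair x by auto
  qed
  obtain B where B: "B \<in> indep K" "B \<subseteq> Q" "card B = rk K Q"
    using rk_attained .
  define V where "V = (\<Union>x \<in> B. ends G (f x))"
  have "finite (ends G (f x))" if "x \<in> Q" for x
    using two[OF that] by (simp add: card_ge_0_finite)
  then have finV: "finite V"
    unfolding V_def using finite_indep[OF B(1)] B by auto
  have "card V \<le> (\<Sum>x \<in> B. card (ends G (f x)))"
    unfolding V_def by (rule card_UN_le) (rule finite_indep[OF B(1)])
  also have "\<dots> = (\<Sum>x \<in> B. 2)"
    using B two by (intro sum.cong) auto
  also have "\<dots> \<le> 2 * rk K (ground K)"
    using B rk_mono[OF Q] by simp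
  finally have cardV: "card V \<le> 2 * rk K (ground K)" .
  have "ends G (f x) \<subseteq> V" if x: "x \<in> Q" for x
  proof (cases "x \<in> B")
    case True
    then show ?thesis by (auto simp: V_def)
  next
    case nB: False
    have sub: "insert x B \<subseteq> ground K" using B Q x by auto
    have "insert x B \<notin> indep K"
      using nB B x card_le_rk[of "insert x B" Q] finite_indep[OF B(1)] by auto
    then obtain C where C: "C \<subseteq> f ` insert x B" "cycle_edge_set G C"
      using ind[OF sub] sub fE by (auto simp: cycle_matroid_def)
    \<comment> \<open>The image of \<open>B\<close> is a forest, so \<open>C\<close> must use
      \<open>f x\<close>. Its other edges come from \<open>B\<close> and cover both ends of
      \<open>f x\<close>.\<close>
    have "f x \<in> C"
    proof (rule ccontr)
      assume "f x \<notin> C"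
      then have "C \<subseteq> f ` B" using C by auto
      then show False using acyclic[OF _ B(1)] C(2) by (metis subset_imageE)
    qed
    from cycle_edge_set_ends_covered[OF C(2) this two[OF x]] C(1) show ?thesis
      by (force simp: V_def)
  qed
  then have "(\<lambda>x. ends G (f x)) ` Q \<subseteq> Pow V" by auto
  \<comment> \<open>Distinct elements with the same ends would form a digon, so \<open>Q\<close> is
    counted by subsets of \<open>V\<close>.\<close>
  moreover have "inj_on (\<lambda>x. ends G (f x)) Q"
  proof (rule inj_onI, rule ccontr)
    fix x y assume xy: "x \<in> Q" "y \<in> Q" "ends G (f x) = ends G (f y)" "x \<noteq> y"
    then have "f x \<noteq> f y" using bij_betw_imp_inj_on[OF f] Q by (auto dest: inj_onD)
    then have "cycle_edge_set G (f ` {x, y})"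
      using xy fE Q two cycle_edge_set_digon[of "f x" G "f y"] by auto
    then show False using acyclic[of "{x, y}"] pair xy by blast
  qed
  ultimately have "card Q \<le> card (Pow V)"
    using finV by (metis card_inj_on_le finite_Pow_iff)
  also have "\<dots> \<le> 2 ^ (2 * rk K (ground K))"
    using finV cardV by (simp add: card_Pow)
  finally show ?thesis .
qed


text \<open>One representative for each closure of a nonloop gives a simple set. All loops share the
  closure \<open>cl K {}\<close>, which accounts for the \<open>+ 1\<close>.\<close>

lemma card_graphic_point_closures_le:
  assumes K: "graphic K"
  shows "card ((\<lambda>x. cl K {x}) ` ground K) \<le> 2 ^ (2 * rk K (ground K)) + 1"
proof -
  interpret matroid K using K by (simp add: graphic_def)
  let ?N = "{x \<in> ground K. rk K {x} = 1}"
  obtain Q where Q: "Q \<subseteq> ?N" "inj_on (\<lambda>x. cl K {x}) Q"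
      "(\<lambda>x. cl K {x}) ` ?N = (\<lambda>x. cl K {x}) ` Q"
    using subset_image_inj[of "(\<lambda>x. cl K {x}) ` ?N" "\<lambda>x. cl K {x}" ?N] by auto
  have "rk K {x, y} = 2" if xy: "x \<in> Q" "y \<in> Q" "x \<noteq> y" for x y
  proof (rule ccontr)
    assume "rk K {x, y} \<noteq> 2"
    then have le: "rk K {x, y} \<le> 1"
      using rk_le_card[of "{x, y}"] xy by auto
    have "rk K {x} = 1" "rk K {y} = 1" "{x, y} \<subseteq> ground K" using xy Q by auto
    then have "{x, y} \<subseteq> cl K {x}" "{x, y} \<subseteq> cl K {y}"
      using le subset_cl_if_rk_le[of "{x}" "{x, y}"] subset_cl_if_rk_le[of "{y}" "{x, y}"] by simp_all
    then have "cl K {x} = cl K {y}"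
      using cl_subset_cl[of "{x}" "{y}"] cl_subset_cl[of "{y}" "{x}"] by auto
    then show False using Q xy by (auto simp: inj_on_def)
  qed
  then have "card Q \<le> 2 ^ (2 * rk K (ground K))"
    using K Q by (intro card_graphic_simple_le) auto
  moreover have "cl K {x} = cl K {}" if "x \<in> ground K" "x \<notin> ?N" for x
  proof -
    have "rk K {x} = 0" using that rk_le_card[of "{x}"] by auto
    then have "x \<in> cl K {}" using that rk_le_card[of "{}"] by (simp add: cl_def)
    then show ?thesis using cl_subset_cl[of "{x}" "{}"] cl_mono[of "{}" "{x}"] by auto
  qed
  then have "(\<lambda>x. cl K {x}) ` ground K \<subseteq> insert (cl K {}) ((\<lambda>x. cl K {x}) ` Q)"
    using Q(3) by blast
  moreover have "finite Q" using Q finite_subset[OF _ finite_ground, of Q] by blast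
  ultimately show ?thesis
    using card_mono[of "insert (cl K {}) ((\<lambda>x. cl K {x}) ` Q)" "(\<lambda>x. cl K {x}) ` ground K"]
      card_image[OF Q(2)]
    by (simp add: card_insert_if split: if_splits)
qed


section \<open>Elementary quotients\<close>

text \<open>The closure inclusion says that the identity from \<open>M\<close> to \<open>K\<close>
  is a strong map; the last conjunct limits the drop of the total rank to one. These are the pairs
  arising from a matroid \<open>N\<close> as \<open>delete N {e}\<close> and
  \<open>contract N {e}\<close>, which is how lifts enter.\<close>

definition elementary_quotient :: "'a matroid \<Rightarrow> 'a matroid \<Rightarrow> bool" where
  "elementary_quotient M K \<longleftrightarrow>
     matroid M \<and> matroid K \<and> ground K = ground M \<and>
     (\<forall>X \<subseteq> ground M. cl M X \<subseteq> cl K X) \<and> rk M (ground M) \<le> rk K (ground M) + 1"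

text \<open>The drop from \<open>rk M\<close> to \<open>rk K\<close> cannot decrease when an element
  is added: where \<open>M\<close> gains no rank, neither does \<open>K\<close>, and otherwise
  \<open>K\<close> gains at most one.\<close>

lemma elementary_quotient_rk_mono:
  assumes quot: "elementary_quotient M K" and AB: "A \<subseteq> B" "B \<subseteq> ground M"
  shows "rk K B + rk M A \<le> rk M B + rk K A"
proof -
  interpret M: matroid M using quot by (simp add: elementary_quotient_def)
  interpret K: matroid K using quot by (simp add: elementary_quotient_def)
  have "rk K (A \<union> C) + rk M A \<le> rk M (A \<union> C) + rk K A" if "finite C" "C \<subseteq> ground M" for C
    using that
  proof (induction C)
    case (insert c C)
    then have IH: "rk K (A \<union> C) + rk M A \<le> rk M (A \<union> C) + rk K A" by blast
    have sub: "A \<union> C \<subseteq> ground M" "c \<in> ground M" using insert AB by auto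
    have "rk K (insert c (A \<union> C)) + rk M (A \<union> C) \<le> rk M (insert c (A \<union> C)) + rk K (A \<union> C)"
    proof (cases "c \<in> cl M (A \<union> C)")
      case True
      then have "c \<in> cl K (A \<union> C)"
        using quot sub unfolding elementary_quotient_def by blast
      with True show ?thesis by (simp add: cl_def)
    next
      case False
      then have "rk M (A \<union> C) < rk M (insert c (A \<union> C))"
        using sub M.rk_mono[OF subset_insertI, of "A \<union> C" c] by (simp add: cl_def)
      then show ?thesis using K.rk_insert_le[of c "A \<union> C"] by linarith
    qed
    then show ?case using IH by simp
  qed simp
  from this[of "B - A"] show ?thesis
    using AB M.finite_ground finite_subset[of B "ground M"] by (auto simp: Un_absorb1)
qed

lemma elementary_quotient_rk:
  assumes quot: "elementary_quotient M K" and X: "X \<subseteq> ground M"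
  shows "rk K X \<le> rk M X" and "rk M X \<le> rk K X + 1"
proof -
  interpret M: matroid M using quot by (simp add: elementary_quotient_def)
  interpret K: matroid K using quot by (simp add: elementary_quotient_def)
  have "rk M {} = 0" "rk K {} = 0" using M.rk_le_card[of "{}"] K.rk_le_card[of "{}"] by auto
  then show "rk K X \<le> rk M X"
    using elementary_quotient_rk_mono[OF quot _ X, of "{}"] by simp
  show "rk M X \<le> rk K X + 1"
    using elementary_quotient_rk_mono[OF quot X subset_refl] quot
    by (simp add: elementary_quotient_def)
qed

text \<open>If \<open>e\<close> is a loop of \<open>N\<close>, contracting it gives \<open>M\<close>
  itself. Otherwise the rank of \<open>X\<close> in the contraction is
  \<open>rk N (insert e X) - 1\<close>, and the closure inclusion follows from diminishing gains of
  rank in \<open>N\<close>.\<close>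

lemma lifted_graphic_imp_elementary_quotient:
  assumes "lifted_graphic M"
  obtains K where "graphic K" "elementary_quotient M K"
proof -
  obtain N e where M: "matroid M" and N: "matroid N" and e: "e \<notin> ground M"
      and gN: "ground N = insert e (ground M)" and del: "delete N {e} = M"
      and gr: "graphic (contract N {e})"
    using assms unfolding lifted_graphic_def by blast
  interpret M: matroid M by fact
  interpret N: matroid N by fact
  define K where "K = contract N {e}"
  interpret K: matroid K using gr by (simp add: graphic_def K_def)
  have gK: "ground K = ground M" using gN e by (simp add: K_def contract_def)
  have indM: "indep M = {X \<in> indep N. X \<subseteq> ground M}"
    using arg_cong[OF del, of indep] gN e by (auto simp: delete_def)
  have rkM: "rk M X = rk N X" if "X \<subseteq> ground M" for X
    using rk_delete[of X N "{e}"] del gN e that by auto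
  show thesis
  proof (cases "{e} \<in> indep N")
    case False
    then have "basis_of N {e} B \<longleftrightarrow> B = {}" for B
      using N.indep_empty by (auto simp: basis_of_def subset_singleton_iff)
    then have "indep K = indep M"
      using indM gN e by (auto simp: K_def contract_def)
    then have "K = M" using gK by simp
    then have "elementary_quotient M K"
      using M by (auto simp: elementary_quotient_def)
    then show thesis using that gr K_def by blast
  next
    case True
    then have "basis_of N {e} B \<longleftrightarrow> B = {e}" for B
      using N.indep_empty by (auto simp: basis_of_def subset_singleton_iff)
    then have indK: "indep K = {X. X \<subseteq> ground M \<and> insert e X \<in> indep N}"
      using gN e by (auto simp: K_def contract_def)
    have rkK: "rk K X + 1 = rk N (insert e X)" if X: "X \<subseteq> ground M" for X
    proof (rule antisym)
      obtain I where I: "I \<in> indep K" "I \<subseteq> X" "card I = rk K X"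
        using K.rk_attained .
      then have "card (insert e I) = card I + 1"
        using e X K.finite_indep by (subst card_insert_disjoint) auto
      then show "rk K X + 1 \<le> rk N (insert e X)"
        using N.card_le_rk[of "insert e I" "insert e X"] I indK by auto
      obtain B where B: "B \<in> indep N" "{e} \<subseteq> B" "B \<subseteq> insert e X" "card B = rk N (insert e X)"
        using N.extend_to_rk[OF True, of "insert e X"] by blast
      then have "B - {e} \<in> indep K" "B - {e} \<subseteq> X"
        using indK X by (auto simp: insert_absorb)
      moreover have "card B = card (B - {e}) + 1"
        using B N.finite_indep[OF B(1)] card_Suc_Diff1[of B e] by simp
      ultimately show "rk N (insert e X) \<le> rk K X + 1"
        using K.card_le_rk[of "B - {e}" X] B by simp
    qed
    have "elementary_quotient M K"
      unfolding elementary_quotient_def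
    proof (intro conjI allI impI subsetI)
      fix X x assume X: "X \<subseteq> ground M" and x: "x \<in> cl M X"
      then have xg: "x \<in> ground M" by (simp add: cl_def)
      then have "rk N (insert x X) = rk N X"
        using x X rkM[of X] rkM[of "insert x X"] by (simp add: cl_def)
      then have "rk N (insert x (insert e X)) = rk N (insert e X)"
        by (rule N.rk_insert_eq_mono[OF subset_insertI])
      then have "rk K (insert x X) = rk K X"
        using rkK[of X] rkK[of "insert x X"] X xg by (simp add: insert_commute)
      then show "x \<in> cl K X" using xg gK by (simp add: cl_def)
    next
      show "rk M (ground M) \<le> rk K (ground M) + 1"
        using rkM[of "ground M"] rkK[of "ground M"] N.rk_mono[of "ground M" "insert e (ground M)"]
        by auto
    qed (use M K.matroid_axioms gK in auto)
    then show thesis using that gr K_def by blast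
  qed
qed

text \<open>
  The lift \<open>N\<close> is recovered from the pair \<open>(M, K)\<close>: its independent sets avoiding \<open>e\<close> are those
  of \<open>M\<close>, and its independent sets containing \<open>e\<close> are those of \<open>K\<close> with \<open>e\<close> added.
\<close>

lemma elementary_quotient_imp_lifted_graphic:
  fixes M :: "'a::infinite matroid"
  assumes K: "graphic K" and quot: "elementary_quotient M K"
  shows "lifted_graphic M"
proof -
  interpret M: matroid M using quot by (simp add: elementary_quotient_def)
  interpret K: matroid K using quot by (simp add: elementary_quotient_def)
  have gK: "ground K = ground M" using quot by (simp add: elementary_quotient_def)
  obtain e where e: "e \<notin> ground M"
    using ex_new_if_finite[OF infinite_UNIV M.finite_ground] by blast
  have eM: "e \<notin> I" if "I \<in> indep M" for I using M.indep_subset_ground[OF that] e by blast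
  have eK: "e \<notin> I" if "I \<in> indep K" for I using K.indep_subset_ground[OF that] e gK by blast
  \<comment> \<open>Ranks in \<open>K\<close> do not exceed those in \<open>M\<close>, so removing
    \<open>e\<close> from an independent set of \<open>N\<close> leaves an independent set of
    \<open>M\<close>.\<close>
  have KM: "I \<in> indep M" if "I \<in> indep K" for I
  proof -
    have "card I \<le> rk M I"
      using elementary_quotient_rk(1)[OF quot, of I] K.rk_indep[OF that]
        K.indep_subset_ground[OF that] gK by simp
    then show ?thesis
      using M.rk_le_card[of I] M.indep_iff_rk[of I] K.finite_indep[OF that] by simp
  qed
  define N where "N = \<lparr>ground = insert e (ground M), indep = indep M \<union> insert e ` indep K\<rparr>"
  have N: "matroid N"
  proof
    fix X Y assume "Y \<in> indep N" and XY: "X \<subseteq> Y"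
    then consider "Y \<in> indep M" | I where "I \<in> indep K" "Y = insert e I"
      by (auto simp: N_def)
    then show "X \<in> indep N"
    proof cases
      case 1
      then show ?thesis using M.indep_mono[of Y X] XY by (simp add: N_def)
    next
      case 2
      then have sub: "X - {e} \<in> indep K" using K.indep_mono[of I "X - {e}"] XY by blast
      show ?thesis
      proof (cases "e \<in> X")
        case True
        then have "X \<in> insert e ` indep K" using sub by (metis image_eqI insert_Diff)
        then show ?thesis by (simp add: N_def)
      next
        case False
        then show ?thesis using KM[OF sub] by (simp add: N_def)
      qed
    qed
  next
    fix X Y assume X: "X \<in> indep N" and Y: "Y \<in> indep N" and less: "card X < card Y"
    have XM: "X \<in> indep M \<or> (\<exists>I. I \<in> indep K \<and> X = insert e I)"
      and YM: "Y \<in> indep M \<or> (\<exists>I. I \<in> indep K \<and> Y = insert e I)"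
      using X Y by (auto simp: N_def)
    have card_e: "card (insert e I) = card I + 1" if "I \<in> indep K" for I
      using eK[OF that] K.finite_indep[OF that] by simp
    from XM show "\<exists>y \<in> Y - X. insert y X \<in> indep N"
    proof (elim disjE exE conjE)
      assume X: "X \<in> indep M"
      from YM show ?thesis
      proof (elim disjE exE conjE)
        assume "Y \<in> indep M"
        then show ?thesis using M.augmentation[OF X _ less] by (auto simp: N_def)
      next
        fix J assume J: "J \<in> indep K" "Y = insert e J"
        show ?thesis
        \<comment> \<open>If \<open>X\<close> is independent in \<open>K\<close>, then
          \<open>e\<close> augments it. Otherwise, if no element of \<open>J\<close> augmented
          \<open>X\<close> in \<open>M\<close>, then \<open>J\<close> would lie in
          \<open>cl M X\<close>, hence in \<open>cl K X\<close>, and \<open>card J\<close> would be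
          less than \<open>card X\<close>.\<close>
        proof (cases "X \<in> indep K")
          case True
          then show ?thesis using J eM[OF X] by (auto simp: N_def)
        next
          case False
          have Xg: "X \<subseteq> ground M" using X M.indep_subset_ground by blast
          have "\<exists>y \<in> J - X. insert y X \<in> indep M"
          proof (rule ccontr)
            assume no: "\<not> ?thesis"
            have "y \<in> cl M X" if "y \<in> J" for y
            proof (cases "y \<in> X")
              case True
              then show ?thesis using M.subset_cl[OF Xg] by blast
            next
              case nX: False
              then have "insert y X \<notin> indep M" using no that by blast
              then have "rk M (insert y X) \<noteq> card (insert y X)"
                using M.indep_iff_rk[of "insert y X"] M.finite_indep[OF X] by simp
              then have "rk M (insert y X) = rk M X"
                using M.rk_insert_le[of y X] M.rk_mono[OF subset_insertI, of X y]
                  M.rk_indep[OF X] M.finite_indep[OF X] nX by simp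
              then show ?thesis
                using that K.indep_subset_ground[OF J(1)] gK by (auto simp: cl_def)
            qed
            then have "J \<subseteq> cl K X"
              using quot Xg unfolding elementary_quotient_def by blast
            then have "rk K J \<le> rk K X"
              using K.rk_Un_subset_cl[of J X] K.rk_mono[of J "X \<union> J"] by simp
            then have "card J \<le> rk K X" using K.rk_indep[OF J(1)] by simp
            moreover have "rk K X < card X"
              using False K.indep_iff_rk[of X] K.rk_le_card[of X] M.finite_indep[OF X] by simp
            ultimately show False using less J card_e[OF J(1)] by simp
          qed
          then show ?thesis using J by (auto simp: N_def)
        qed
      qed
    next
      fix I assume I: "I \<in> indep K" "X = insert e I"
      \<comment> \<open>Both sets are compared inside \<open>K\<close>. If \<open>Y\<close> is
        independent in \<open>M\<close>, its rank in \<open>K\<close> is at least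
        \<open>card Y - 1\<close>, which still exceeds \<open>card I\<close> because
        \<open>X\<close> also contains \<open>e\<close>.\<close>
      have "\<exists>J. J \<in> indep K \<and> J \<subseteq> Y \<and> card I < card J"
        using YM
      proof (elim disjE exE conjE)
        assume Y: "Y \<in> indep M"
        obtain J where J: "J \<in> indep K" "J \<subseteq> Y" "card J = rk K Y"
          using K.rk_attained .
        have "card Y \<le> rk K Y + 1"
          using elementary_quotient_rk(2)[OF quot, of Y] M.rk_indep[OF Y]
            M.indep_subset_ground[OF Y] by simp
        then show ?thesis using J less I card_e[OF I(1)] by auto
      next
        fix J assume "J \<in> indep K" "Y = insert e J"
        then show ?thesis using less I card_e by auto
      qed
      then obtain J where J: "J \<in> indep K" "J \<subseteq> Y" "card I < card J" by blast
      then obtain y where y: "y \<in> J - I" "insert y I \<in> indep K"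
        using K.augmentation[OF I(1)] by blast
      then have "y \<noteq> e" using eK[OF J(1)] by blast
      then have "y \<in> Y - X" "insert y X \<in> indep N"
        using y J I by (auto simp: N_def insert_commute)
      then show ?thesis by blast
    qed
  next
    fix X assume "X \<in> indep N"
    then show "X \<subseteq> ground N"
      using M.indep_subset_ground K.indep_subset_ground gK by (auto simp: N_def)
  qed (auto simp: N_def M.finite_ground M.indep_empty)
  have "basis_of N {e} B \<longleftrightarrow> B = {e}" for B
    using K.indep_empty by (auto simp: N_def basis_of_def subset_singleton_iff)
  then have "indep (contract N {e}) = {X. X \<subseteq> ground M \<and> insert e X \<in> indep N}"
    using e by (auto simp: contract_def N_def)
  also have "\<dots> = indep K"
  proof (intro equalityI subsetI)
    fix X assume "X \<in> {X. X \<subseteq> ground M \<and> insert e X \<in> indep N}"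
    then have X: "X \<subseteq> ground M" "insert e X \<in> indep N" by auto
    then obtain I where I: "I \<in> indep K" "insert e X = insert e I"
      using eM[of "insert e X"] by (auto simp: N_def)
    then have "X = I" using X e eK[OF I(1)] by (auto simp: set_eq_iff)
    then show "X \<in> indep K" using I by simp
  next
    fix X assume "X \<in> indep K"
    then show "X \<in> {X. X \<subseteq> ground M \<and> insert e X \<in> indep N}"
      using K.indep_subset_ground gK by (auto simp: N_def)
  qed
  finally have "contract N {e} = K"
    using e gK by (simp add: contract_def N_def)
  moreover have "indep (delete N {e}) = indep M"
    using e eM M.indep_subset_ground by (auto simp: delete_def N_def)
  then have "delete N {e} = M"
    using e by (simp add: N_def)
  ultimately show ?thesis
    unfolding lifted_graphic_def using M.matroid_axioms N e K
    by (intro conjI exI[of _ N] exI[of _ e]) (auto simp: N_def)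
qed

text \<open>Add \<open>e\<close> to \<open>K\<close> as a copy of \<open>a\<close>. For sets that
  avoid \<open>e\<close> but span it, \<open>closed\<close> gives the closure inclusion. In a set
  containing \<open>e\<close>, exchange \<open>e\<close> for \<open>A\<close>, which spans
  \<open>e\<close> in \<open>M\<close> and lies in the closure of \<open>a\<close> in
  \<open>K\<close>. The contrapositive produces the obstructions.\<close>

lemma lifted_graphic_if_parallel_extension:
  fixes M :: "'a::infinite matroid"
  assumes M: "matroid M" and e: "e \<in> ground M"
    and K: "graphic K" and quot: "elementary_quotient (delete M {e}) K"
    and A: "A \<subseteq> ground M - {e}" "a \<in> A" "A \<subseteq> cl K {a}" "e \<in> cl M A"
    and closed: "\<And>X. X \<subseteq> ground M - {e} \<Longrightarrow> e \<in> cl M X \<Longrightarrow> a \<in> cl K X"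
  shows "lifted_graphic M"
proof -
  interpret M: matroid M by fact
  interpret K: matroid K using quot by (simp add: elementary_quotient_def)
  have gK: "ground K = ground M - {e}" using quot by (simp add: elementary_quotient_def)
  define \<phi> where "\<phi> = (\<lambda>x. if x = e then a else x)"
  define K' where "K' = inverse_image \<phi> (ground M) K"
  have \<phi>: "\<phi> ` ground M = ground M - {e}" using A e by (auto simp: \<phi>_def)
  have gr: "graphic K'"
    unfolding K'_def using K M.finite_ground \<phi> gK by (intro graphic_inverse_image) auto
  have rkK': "rk K' X = rk K (\<phi> ` X)" if "X \<subseteq> ground M" for X
    unfolding K'_def by (rule rk_inverse_image[OF K.matroid_axioms M.finite_ground that])
  have cl: "cl M X - {e} \<subseteq> cl K X" if "X \<subseteq> ground M - {e}" for X
  proof -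
    have "cl (delete M {e}) X \<subseteq> cl K X"
      using quot that unfolding elementary_quotient_def ground_delete by blast
    then show ?thesis by (simp add: cl_delete[OF that])
  qed
  have main: "\<phi> x \<in> cl K (\<phi> ` X)" if X: "X \<subseteq> ground M" and x: "x \<in> cl M X" for X x
  proof (cases "e \<in> X")
    case False
    then have "X \<subseteq> ground M - {e}" "\<phi> ` X = X" using X by (auto simp: \<phi>_def)
    then show ?thesis using cl[of X] closed[of X] x by (auto simp: \<phi>_def)
  next
    case True
    define Y where "Y = X - {e}"
    have Y: "Y \<subseteq> ground M - {e}" "X = insert e Y" using X True by (auto simp: Y_def)
    have im: "\<phi> ` X = insert a Y" using Y by (auto simp: \<phi>_def)
    have aY: "insert a Y \<subseteq> ground K" using A Y gK by auto
    show ?thesis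
    proof (cases "x = e")
      case True
      then show ?thesis using im K.subset_cl[OF aY] by (auto simp: \<phi>_def)
    next
      case False
      have YA: "Y \<union> A \<subseteq> ground M - {e}" using Y A by auto
      have "X \<subseteq> cl M (Y \<union> A)"
        using Y M.subset_cl[of "Y \<union> A"] YA M.cl_mono[of A "Y \<union> A"] A by auto
      then have "x \<in> cl K (Y \<union> A)"
        using M.cl_subset_cl[of X "Y \<union> A"] x False cl[OF YA] by auto
      moreover have "Y \<union> A \<subseteq> cl K (insert a Y)"
        using K.subset_cl[OF aY] K.cl_mono[of "{a}" "insert a Y"] A by auto
      ultimately show ?thesis
        using K.cl_subset_cl[of "Y \<union> A" "insert a Y"] False im by (auto simp: \<phi>_def)
    qed
  qed
  have "elementary_quotient M K'"
    unfolding elementary_quotient_def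
  proof (intro conjI allI impI subsetI)
    fix X x assume X: "X \<subseteq> ground M" "x \<in> cl M X"
    then have "x \<in> ground M" by (simp add: cl_def)
    then show "x \<in> cl K' X"
      using main[OF X] X rkK'[of X] rkK'[of "insert x X"] by (simp add: cl_def K'_def)
  next
    \<comment> \<open>Since the other elements span \<open>e\<close>, deleting it keeps the rank, so
      the total drop is the one from \<open>delete M {e}\<close> to \<open>K\<close>.\<close>
    have "e \<in> cl M (ground M - {e})" using A M.cl_mono by blast
    then have "rk M (ground M) = rk M (ground M - {e})"
      using e by (simp add: cl_def insert_absorb)
    then show "rk M (ground M) \<le> rk K' (ground M) + 1"
      using quot rkK'[of "ground M"] \<phi> rk_delete[of "ground M - {e}" M "{e}"]
      by (simp add: elementary_quotient_def)
  qed (use M gr in \<open>auto simp: graphic_def K'_def\<close>)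
  then show ?thesis using gr elementary_quotient_imp_lifted_graphic by blast
qed


section \<open>Excluded minors\<close>

lemma excluded_minor_delete:
  assumes "excluded_minor P M" "e \<in> ground M"
  shows "P (delete M {e})"
proof -
  interpret matroid M using assms by (simp add: excluded_minor_def)
  have "basis_of M {} B \<longleftrightarrow> B = {}" for B
    using indep_empty by (auto simp: basis_of_def)
  then have "indep (contract M {}) = indep M" "ground (contract M {}) = ground M"
    using indep_subset_ground by (auto simp: contract_def)
  then have "contract M {} = M" by simp
  then have "is_minor (delete M {e}) M"
    unfolding is_minor_def using assms(2) by (intro exI[of _ "{}"] exI[of _ "{e}"]) auto
  moreover have "delete M {e} \<noteq> M"
    using assms(2) ground_delete[of M "{e}"] by force
  ultimately show ?thesis
    using assms(1) by (simp add: excluded_minor_def proper_minor_def)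
qed

lemma large_fibre:
  assumes "finite A" "m * card (f ` A) < card A"
  obtains a where "a \<in> A" "m < card {x \<in> A. f x = f a}"
proof -
  have "\<exists>a \<in> A. m < card {x \<in> A. f x = f a}"
  proof (rule ccontr)
    assume "\<not> ?thesis"
    then have "(\<Sum>b \<in> f ` A. card {x \<in> A. f x = b}) \<le> of_nat (card (f ` A)) * m"
      by (intro sum_bounded_above) auto
    moreover have "card A = (\<Sum>b \<in> f ` A. card {x \<in> A. f x = b})"
      using assms(1) by (simp only: card_eq_sum sum.image_gen[of A _ f])
    ultimately show False using assms(2) by (simp add: mult.commute)
  qed
  then show thesis using that by blast
qed

section \<open>Bounding the size of an excluded minor\<close>

locale lifted_graphic_excluded_minor = matroid M for M :: "'a::infinite matroid" +
  assumes excluded: "excluded_minor lifted_graphic M"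
begin

definition nonloops :: "'a set" where
  "nonloops = {x \<in> ground M. rk M {x} = 1}"

text \<open>A graphic quotient of a single-element deletion of \<open>M\<close> has rank at most
  that of \<open>M\<close>, so this bounds the size of its simple restrictions.\<close>

definition class_bound :: nat where
  "class_bound = 2 ^ (2 * rk M (ground M))"

lemma nonloops_subset: "nonloops \<subseteq> ground M"
  by (auto simp: nonloops_def)

lemma finite_nonloops: "finite nonloops"
  using finite_subset[OF nonloops_subset finite_ground] .

lemma class_bound_pos: "class_bound \<ge> 1"
  by (simp add: class_bound_def)

lemma delete_quotient:
  assumes "e \<in> ground M"
  obtains K where "graphic K" "elementary_quotient (delete M {e}) K"
  using lifted_graphic_imp_elementary_quotient[OF excluded_minor_delete[OF excluded assms]] .

lemma not_lifted_graphic: "\<not> lifted_graphic M"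
  using excluded by (simp add: excluded_minor_def)

text \<open>Every set spanning \<open>x\<close> also spans \<open>y\<close>, so a graphic quotient
  of \<open>delete M {x}\<close> extends by a copy of \<open>y\<close>. Two loops lie in each
  other's closure, so this also leaves at most one loop.\<close>

lemma no_parallel_pair:
  assumes "x \<in> ground M" "y \<in> ground M" "x \<noteq> y" "x \<in> cl M {y}" "y \<in> cl M {x}"
  shows False
proof -
  obtain K where K: "graphic K" "elementary_quotient (delete M {x}) K"
    using delete_quotient assms(1) .
  then interpret K: matroid K by (simp add: graphic_def)
  have gK: "ground K = ground M - {x}" using K by (simp add: elementary_quotient_def)
  have "y \<in> cl K X" if X: "X \<subseteq> ground M - {x}" "x \<in> cl M X" for X
  proof -
    have "y \<in> cl M X" using cl_subset_cl[of "{x}" X] X assms by auto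
    then have "y \<in> cl (delete M {x}) X" using assms by (simp add: cl_delete[OF X(1)])
    then show ?thesis using K X unfolding elementary_quotient_def ground_delete by blast
  qed
  then have "lifted_graphic M"
    using assms gK K.subset_cl[of "{y}"]
    by (intro lifted_graphic_if_parallel_extension[OF matroid_axioms assms(1) K, of "{y}" y]) auto
  then show False using not_lifted_graphic by simp
qed

lemma rk_nonloop_pair:
  assumes "x \<in> nonloops" "y \<in> nonloops" "x \<noteq> y"
  shows "rk M {x, y} = 2"
proof (rule ccontr)
  assume "rk M {x, y} \<noteq> 2"
  then have "rk M {x, y} \<le> 1" using rk_le_card[of "{x, y}"] assms by auto
  then have "{x, y} \<subseteq> cl M {x}" "{x, y} \<subseteq> cl M {y}"
    using assms subset_cl_if_rk_le[of "{x}" "{x, y}"] subset_cl_if_rk_le[of "{y}" "{x, y}"]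
    by (simp_all add: nonloops_def)
  then show False using no_parallel_pair[of x y] assms by (auto simp: nonloops_def)
qed

lemma card_nonloops: "card (ground M) \<le> card nonloops + 1"
proof -
  have loop: "x \<in> cl M X" if "x \<in> ground M - nonloops" for x X
  proof -
    have "rk M {x} = 0" using that rk_le_card[of "{x}"] by (auto simp: nonloops_def)
    then have "x \<in> cl M {}" using that rk_le_card[of "{}"] by (simp add: cl_def)
    then show ?thesis using cl_mono[of "{}" X] by auto
  qed
  have "x = y" if "x \<in> ground M - nonloops" "y \<in> ground M - nonloops" for x y
    using no_parallel_pair[of x y] loop that by blast
  then have "card (ground M - nonloops) \<le> 1"
    using finite_ground by (simp add: card_le_Suc0_iff_eq)
  then show ?thesis
    using card_Diff_subset[OF finite_nonloops nonloops_subset] by linarith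
qed

lemma rk_delete_quotient:
  assumes K: "elementary_quotient (delete M {e}) K" and X: "X \<subseteq> ground M - {e}"
  shows "rk K X \<le> rk M X" and "rk M X \<le> rk K X + 1"
  using elementary_quotient_rk[OF K, of X] X by (simp_all add: rk_delete)

lemma rk_ground_delete_quotient:
  assumes "elementary_quotient (delete M {e}) K"
  shows "rk K (ground K) \<le> rk M (ground M)"
  using rk_delete_quotient(1)[OF assms, of "ground M - {e}"] rk_mono[of "ground M - {e}" "ground M"]
    assms by (simp add: elementary_quotient_def)

text \<open>A line of \<open>M\<close> keeping its rank in \<open>K\<close> would be a large simple restriction of \<open>K\<close>.\<close>

lemma long_line_collapses:
  assumes K: "graphic K" "elementary_quotient (delete M {e}) K"
    and P: "P \<subseteq> nonloops - {e}" "rk M P \<le> 2" "class_bound < card P"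
  shows "rk K P \<le> 1"
proof (rule ccontr)
  assume gt: "\<not> rk K P \<le> 1"
  interpret K: matroid K using K by (simp add: graphic_def)
  have sub: "P \<subseteq> ground M - {e}" using P nonloops_subset by blast
  have gK: "ground K = ground M - {e}" using K by (simp add: elementary_quotient_def)
  \<comment> \<open>If \<open>P\<close> keeps rank 2, then no pair in it loses rank, as the drop is
    monotone. So \<open>P\<close> would be simple in \<open>K\<close>, and too large.\<close>
  have "rk K {x, y} = 2" if xy: "x \<in> P" "y \<in> P" "x \<noteq> y" for x y
  proof -
    have "rk K P + rk M {x, y} \<le> rk M P + rk K {x, y}"
      using elementary_quotient_rk_mono[OF K(2), of "{x, y}" P] xy sub
        rk_delete[OF sub] rk_delete[of "{x, y}" M "{e}"] by (simp add: subset_iff)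
    moreover have "rk M {x, y} = 2" using rk_nonloop_pair xy P by blast
    moreover have "rk K {x, y} \<le> 2" using K.rk_le_card[of "{x, y}"] xy by simp
    ultimately show ?thesis using gt P by linarith
  qed
  then have "card P \<le> 2 ^ (2 * rk K (ground K))"
    using sub gK by (intro card_graphic_simple_le[OF K(1)]) auto
  also have "\<dots> \<le> class_bound"
    using rk_ground_delete_quotient[OF K(2)] by (simp add: class_bound_def)
  finally show False using P by simp
qed

text \<open>
  The colour of \<open>x\<close> is its parallel class in a graphic quotient of some \<open>M \ g\<close>, if that class is
  large, and \<open>{x}\<close> otherwise.
\<close>

lemma line_colouring:
  obtains c :: "'a \<Rightarrow> 'a set" where
    "card (c ` nonloops) \<le> (class_bound + 2) ^ 2"
    "\<And>x y. x \<in> nonloops \<Longrightarrow> y \<in> nonloops \<Longrightarrow> x \<noteq> y \<Longrightarrow> c x = c y \<Longrightarrow>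
       {x, y} \<subseteq> c x \<and> c x \<subseteq> nonloops \<and> rk M (c x) \<le> 2 \<and> class_bound + 1 < card (c x)"
proof (cases "ground M = {}")
  case True
  then have "nonloops = {}" by (auto simp: nonloops_def)
  then show thesis using that[of "\<lambda>x. {}"] by simp
next
  case False
  then obtain g where g: "g \<in> ground M" by blast
  obtain K where K: "graphic K" "elementary_quotient (delete M {g}) K"
    using delete_quotient g .
  interpret K: matroid K using K by (simp add: graphic_def)
  have gK: "ground K = ground M - {g}" using K by (simp add: elementary_quotient_def)
  let ?h = "class_bound"
  \<comment> \<open>\<open>P x\<close> also picks up loops of \<open>K\<close> that are nonloops of
    \<open>M\<close>. The threshold \<open>?h + 1\<close> below leaves more than \<open>?h\<close>
    elements after one is deleted.\<close>
  define P where "P x = cl K {x} \<inter> nonloops" for x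
  define c where "c x = (if x \<noteq> g \<and> ?h + 1 < card (P x) then P x else {x})" for x
  define \<P> where "\<P> = P ` ground K"
  have finP: "finite (P x)" for x unfolding P_def using finite_nonloops by blast
  have "\<P> = (\<lambda>p. p \<inter> nonloops) ` (\<lambda>x. cl K {x}) ` ground K"
    by (simp add: \<P>_def P_def image_image)
  then have "card \<P> \<le> card ((\<lambda>x. cl K {x}) ` ground K)"
    using K.finite_ground by (simp add: card_image_le)
  also have "\<dots> \<le> ?h + 1"
  proof -
    have "(2::nat) ^ (2 * rk K (ground K)) \<le> ?h"
      using rk_ground_delete_quotient[OF K(2)] by (simp add: class_bound_def)
    then show ?thesis using card_graphic_point_closures_le[OF K(1)] by linarith
  qed
  finally have card\<P>: "card \<P> \<le> ?h + 1" .
  have fin\<P>: "finite \<P>" unfolding \<P>_def using K.finite_ground by blast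
  have mem: "x \<in> P x" if "x \<in> nonloops" "x \<noteq> g" for x
    using that K.subset_cl[of "{x}"] gK nonloops_subset by (auto simp: P_def)
  have mem_c: "x \<in> c x" if "x \<in> nonloops" for x
    using that mem by (auto simp: c_def)
  \<comment> \<open>\<open>S\<close> holds the elements that may get a singleton colour:
    \<open>g\<close> and at most \<open>?h + 1\<close> small classes of at most
    \<open>?h + 1\<close> elements each.\<close>
  define U where "U = (\<Union>p \<in> {p \<in> \<P>. card p \<le> ?h + 1}. p)"
  define S where "S = insert g U"
  have finU: "finite U"
    unfolding U_def using fin\<P> finP by (auto simp: \<P>_def)
  then have finS: "finite S" by (simp add: S_def)
  have "card U \<le> (\<Sum>p \<in> {p \<in> \<P>. card p \<le> ?h + 1}. card p)"
    unfolding U_def using fin\<P> by (intro card_UN_le) auto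
  also have "\<dots> \<le> of_nat (card {p \<in> \<P>. card p \<le> ?h + 1}) * (?h + 1)"
    by (intro sum_bounded_above) auto
  also have "\<dots> \<le> (?h + 1) * (?h + 1)"
    using card\<P> card_mono[OF fin\<P>, of "{p \<in> \<P>. card p \<le> ?h + 1}"]
    by (intro mult_le_mono) auto
  finally have "card S \<le> (?h + 1) * (?h + 1) + 1"
    using finU by (simp add: S_def card_insert_if)
  have "c ` nonloops \<subseteq> \<P> \<union> (\<lambda>x. {x}) ` S"
  proof
    fix p assume "p \<in> c ` nonloops"
    then obtain x where x: "x \<in> nonloops" "p = c x" by blast
    show "p \<in> \<P> \<union> (\<lambda>x. {x}) ` S"
    proof (cases "x = g")
      case True
      then show ?thesis using x by (simp add: c_def S_def)
    next
      case False
      then have "P x \<in> \<P>" "x \<in> P x"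
        using x mem gK nonloops_subset by (auto simp: \<P>_def)
      moreover from this have "x \<in> S" if "\<not> ?h + 1 < card (P x)"
        using that not_less by (auto simp: S_def U_def)
      ultimately show ?thesis using x False by (simp add: c_def image_iff)
    qed
  qed
  then have "card (c ` nonloops) \<le> card (\<P> \<union> (\<lambda>x. {x}) ` S)"
    using fin\<P> finS by (intro card_mono) auto
  also have "\<dots> \<le> card \<P> + card S"
    using card_Un_le[of \<P> "(\<lambda>x. {x}) ` S"] card_image_le[OF finS, of "\<lambda>x. {x}"] by linarith
  also have "\<dots> \<le> (?h + 2) ^ 2"
    using card\<P> \<open>card S \<le> _\<close> by (simp add: power2_eq_square)
  finally have "card (c ` nonloops) \<le> (?h + 2) ^ 2" .
  \<comment> \<open>A colour shared by two elements is not a singleton, so it is \<open>P x\<close>.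
    Its rank in \<open>K\<close> is at most 1, and passing back to \<open>M\<close> adds at most
    one.\<close>
  moreover have "{x, y} \<subseteq> c x \<and> c x \<subseteq> nonloops \<and> rk M (c x) \<le> 2 \<and> ?h + 1 < card (c x)"
    if xy: "x \<in> nonloops" "y \<in> nonloops" "x \<noteq> y" "c x = c y" for x y
  proof -
    have "y \<in> c x" "x \<in> c x" using mem_c xy by auto
    then have "c x \<noteq> {x}" using xy(3) by auto
    then have large: "x \<noteq> g \<and> ?h + 1 < card (P x)" using c_def[of x] by presburger
    then have cx: "x \<noteq> g" "?h + 1 < card (P x)" "c x = P x"
      using c_def[of x] by presburger+
    then have x: "x \<in> ground K" using xy gK nonloops_subset by blast
    have "P x \<subseteq> ground M - {g}" using cl_subset_ground[of K "{x}"] gK by (auto simp: P_def)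
    then have "rk M (P x) \<le> rk K (P x) + 1" by (rule rk_delete_quotient(2)[OF K(2)])
    moreover have "rk K (P x) \<le> rk K (cl K {x})" by (intro K.rk_mono) (auto simp: P_def)
    moreover have "rk K (cl K {x}) \<le> 1"
      using K.rk_cl[of "{x}"] x K.rk_le_card[of "{x}"] by simp
    ultimately have "rk M (P x) \<le> 2" by linarith
    then show ?thesis using \<open>y \<in> c x\<close> \<open>x \<in> c x\<close> cx by (auto simp: P_def)
  qed
  ultimately show thesis using that by blast
qed

text \<open>
  For \<open>f\<close> on a long line \<open>L\<close>, the element \<open>f\<close> cannot be placed parallel to the rest of \<open>L\<close> in a
  graphic quotient \<open>K\<close> of \<open>M \ f\<close>; the set \<open>X\<close> is the obstruction.
\<close>

lemma obstruction:
  assumes L: "L \<subseteq> nonloops" "rk M L \<le> 2" "class_bound + 1 < card L" and f: "f \<in> L"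
  obtains K X where "graphic K" "elementary_quotient (delete M {f}) K"
    "X \<in> indep M" "f \<in> cl M X" "X \<inter> L = {}"
    "\<And>b. b \<in> L - {f} \<Longrightarrow> rk K {b} \<noteq> 0 \<Longrightarrow> b \<notin> cl K X"
proof -
  have Lg: "L \<subseteq> ground M" and fg: "f \<in> ground M" using L f nonloops_subset by auto
  have finL: "finite L" using L finite_nonloops finite_subset by blast
  obtain K where K: "graphic K" "elementary_quotient (delete M {f}) K"
    using delete_quotient fg .
  interpret K: matroid K using K by (simp add: graphic_def)
  have gK: "ground K = ground M - {f}" using K by (simp add: elementary_quotient_def)
  let ?A = "L - {f}"
  have cardA: "class_bound < card ?A" using L f finL by simp
  have A: "?A \<subseteq> ground M - {f}" using Lg by blast
  have rkA: "rk K ?A \<le> 1"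
    using L cardA rk_mono[of ?A L] by (intro long_line_collapses[OF K]) auto
  have "\<not> card ?A \<le> 1" using cardA class_bound_pos by linarith
  then obtain a1 a2 where a12: "a1 \<in> ?A" "a2 \<in> ?A" "a1 \<noteq> a2"
    using finL by (auto simp: card_le_Suc0_iff_eq)
  have span: "L \<subseteq> cl M {x, y}" if "x \<in> L" "y \<in> L" "x \<noteq> y" for x y
  proof -
    have "rk M {x, y} = 2" using that L by (intro rk_nonloop_pair) auto
    then show ?thesis using that L Lg by (intro subset_cl_if_rk_le) auto
  qed
  \<comment> \<open>The rank of \<open>?A\<close> in \<open>M\<close> is at least 2 and drops by at
    most one, so \<open>?A\<close> contains a nonloop of \<open>K\<close>.\<close>
  have "1 \<le> rk K ?A"
  proof -
    have "rk M {a1, a2} = 2" using a12 L by (intro rk_nonloop_pair) auto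
    then show ?thesis
      using rk_delete_quotient(2)[OF K(2) A] rk_mono[of "{a1, a2}" ?A] a12 by simp
  qed
  have parallel: "?A \<subseteq> cl K {b}" if "b \<in> ?A" "rk K {b} \<noteq> 0" for b
    using that rkA A gK by (intro K.subset_cl_if_rk_le) auto
  have "\<exists>a \<in> ?A. rk K {a} \<noteq> 0"
  proof (rule ccontr)
    assume "\<not> ?thesis"
    then have "?A \<subseteq> cl K {}"
      using A gK K.rk_le_card[of "{}"] by (auto simp: cl_def)
    then have "rk K ?A = 0" using K.rk_Un_subset_cl[of ?A "{}"] K.rk_le_card[of "{}"] by simp
    then show False using \<open>1 \<le> rk K ?A\<close> by simp
  qed
  then obtain a where a: "a \<in> ?A" "rk K {a} \<noteq> 0" by blast
  have "f \<in> cl M ?A"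
    using span[of a1 a2] a12 f cl_mono[of "{a1, a2}" ?A] by auto
  \<comment> \<open>The other hypotheses of the parallel extension hold, so some set violates
    \<open>closed\<close>. A basis of it in \<open>M\<close> still spans \<open>f\<close> in
    \<open>M\<close> and still does not span \<open>a\<close> in \<open>K\<close>.\<close>
  then have "\<exists>X. X \<subseteq> ground M - {f} \<and> f \<in> cl M X \<and> a \<notin> cl K X"
    using lifted_graphic_if_parallel_extension[OF matroid_axioms fg K A a(1) parallel[OF a]]
      not_lifted_graphic by blast
  then obtain X' where X': "X' \<subseteq> ground M - {f}" "f \<in> cl M X'" "a \<notin> cl K X'" by blast
  obtain X where X: "X \<in> indep M" "X \<subseteq> X'" "card X = rk M X'" using rk_attained .
  have "X' \<subseteq> cl M X" using X X' rk_indep[OF X(1)] by (intro subset_cl_if_rk_le) auto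
  then have fX: "f \<in> cl M X" using cl_subset_cl X' by blast
  have Xg: "X \<subseteq> ground M - {f}" using X X' by blast
  have aX: "a \<notin> cl K X" using K.cl_mono[OF X(2)] X' by blast
  have clX: "x \<in> cl K X" if "x \<in> cl M X" "x \<noteq> f" for x
  proof -
    have "x \<in> cl (delete M {f}) X" using that by (simp add: cl_delete[OF Xg])
    then show ?thesis using K Xg unfolding elementary_quotient_def ground_delete by blast
  qed
  \<comment> \<open>An element of \<open>X\<close> on \<open>L\<close> would span \<open>L\<close>
    together with \<open>f\<close>, forcing \<open>a\<close> into \<open>cl M X\<close> and so into
    \<open>cl K X\<close>.\<close>
  have "X \<inter> L = {}"
  proof (rule ccontr)
    assume "X \<inter> L \<noteq> {}"
    then obtain b where b: "b \<in> X" "b \<in> L" "b \<noteq> f" using Xg by auto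
    have "{b, f} \<subseteq> cl M X" using b fX subset_cl[of X] Xg by auto
    then have "a \<in> cl M X" using span[of b f] b f a cl_subset_cl[of "{b, f}" X] by auto
    then show False using clX[of a] a aX by simp
  qed
  moreover have "b \<notin> cl K X" if "b \<in> ?A" "rk K {b} \<noteq> 0" for b
    using parallel[OF that] K.cl_subset_cl[of "{b}" X] a aX by auto
  ultimately show thesis using that K X(1) fX by blast
qed

text \<open>
  If \<open>e\<close> and \<open>f\<close> on \<open>L\<close> have obstructions of the same colours, these have the same closure in the
  quotient of \<open>M \ f\<close>, so this closure contains \<open>e\<close>, contradicting the choice of the obstruction of \<open>f\<close>.
\<close>

lemma card_nonloops_le:
  "card nonloops \<le> (2 * 2 ^ ((class_bound + 2) ^ 2) + class_bound + 1) * (class_bound + 2) ^ 2"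
proof (rule ccontr)
  let ?h = "class_bound"
  let ?q = "(?h + 2) ^ 2"
  \<comment> \<open>\<open>2 ^ ?q\<close> bounds the number of colour sets of obstructions, and the
    factor 2 yields a fibre with \<open>f\<close> and two further elements. The summand
    \<open>?h + 1\<close> keeps the line long after a deletion.\<close>
  let ?m = "2 * 2 ^ ?q + ?h + 1"
  assume "\<not> card nonloops \<le> ?m * ?q"
  moreover obtain c :: "'a \<Rightarrow> 'a set" where card_c: "card (c ` nonloops) \<le> ?q"
    and c: "\<And>x y. x \<in> nonloops \<Longrightarrow> y \<in> nonloops \<Longrightarrow> x \<noteq> y \<Longrightarrow> c x = c y \<Longrightarrow>
       {x, y} \<subseteq> c x \<and> c x \<subseteq> nonloops \<and> rk M (c x) \<le> 2 \<and> ?h + 1 < card (c x)"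
    using line_colouring by blast
  ultimately have "?m * card (c ` nonloops) < card nonloops"
    using mult_le_mono2[OF card_c, of ?m] by linarith
  then obtain z where z: "z \<in> nonloops" "?m < card {x \<in> nonloops. c x = c z}"
    using large_fibre[OF finite_nonloops] by blast
  then have "\<not> card {x \<in> nonloops. c x = c z} \<le> 1" by linarith
  then obtain z' where z': "z' \<in> nonloops" "c z' = c z" "z' \<noteq> z"
    using finite_nonloops by (auto simp: card_le_Suc0_iff_eq)
  have cz: "c z \<subseteq> nonloops" "rk M (c z) \<le> 2" using c[of z z'] z z' by auto
  have "x \<in> c z" if "x \<in> nonloops" "c x = c z" for x
    using c[of z z'] c[of z x] z z' that by (cases "x = z") auto
  then have "{x \<in> nonloops. c x = c z} \<subseteq> c z" by blast
  then have "?m < card (c z)"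
    using z(2) card_mono[OF finite_subset[OF cz(1) finite_nonloops]] less_le_trans by blast
  \<comment> \<open>The line is closed up so that it spans no nonloop outside itself; this keeps
    such elements nonloops in the quotients below.\<close>
  define L where "L = cl M (c z) \<inter> nonloops"
  have czL: "c z \<subseteq> L" using cz subset_cl nonloops_subset by (auto simp: L_def)
  have L: "L \<subseteq> nonloops" by (simp add: L_def)
  have finL: "finite L" using L finite_nonloops finite_subset by blast
  have rkL: "rk M L \<le> 2"
    using rk_mono[of L "cl M (c z)"] rk_cl[of "c z"] cz nonloops_subset by (auto simp: L_def)
  have closedL: "x \<in> L" if "x \<in> nonloops" "x \<in> cl M L" for x
    using that cl_subset_cl[of L "c z"] by (auto simp: L_def)
  have cardL: "?m < card L" using \<open>?m < card (c z)\<close> card_mono[OF finL czL] by linarith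
  define obs where "obs f K X \<longleftrightarrow> graphic K \<and> elementary_quotient (delete M {f}) K \<and>
      X \<in> indep M \<and> f \<in> cl M X \<and> X \<inter> L = {} \<and>
      (\<forall>b \<in> L - {f}. rk K {b} \<noteq> 0 \<longrightarrow> b \<notin> cl K X)" for f K X
  have "\<exists>K X. obs f K X" if "f \<in> L" for f
  proof -
    have "?h + 1 < card L" using cardL by linarith
    from obstruction[OF L rkL this that] show ?thesis unfolding obs_def by metis
  qed
  then obtain K X where "\<And>f. f \<in> L \<Longrightarrow> obs f (K f) (X f)" by metis
  then have KX: "\<And>f. f \<in> L \<Longrightarrow> graphic (K f)"
      "\<And>f. f \<in> L \<Longrightarrow> elementary_quotient (delete M {f}) (K f)"
      "\<And>f. f \<in> L \<Longrightarrow> X f \<in> indep M" "\<And>f. f \<in> L \<Longrightarrow> f \<in> cl M (X f)"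
      "\<And>f. f \<in> L \<Longrightarrow> X f \<inter> L = {}"
      "\<And>f b. f \<in> L \<Longrightarrow> b \<in> L - {f} \<Longrightarrow> rk (K f) {b} \<noteq> 0 \<Longrightarrow> b \<notin> cl (K f) (X f)"
    by (simp_all add: obs_def)
  have Xnl: "X f \<subseteq> nonloops" if "f \<in> L" for f
  proof
    fix x assume "x \<in> X f"
    then have "{x} \<in> indep M" using KX(3)[OF that] indep_mono by blast
    then show "x \<in> nonloops"
      using rk_indep[of "{x}"] indep_subset_ground[of "{x}"] by (simp add: nonloops_def)
  qed
  define T where "T f = c ` X f" for f
  have "T ` L \<subseteq> Pow (c ` nonloops)" using Xnl by (auto simp: T_def)
  then have "card (T ` L) \<le> 2 ^ card (c ` nonloops)"
    using card_mono[of "Pow (c ` nonloops)"] finite_nonloops by (simp add: card_Pow)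
  also have "\<dots> \<le> 2 ^ ?q" using card_c by simp
  finally have "2 * card (T ` L) < card L" using cardL by linarith
  then obtain f where f: "f \<in> L" and "2 < card {x \<in> L. T x = T f}"
    using large_fibre[OF finL] by blast
  then have "\<not> card ({x \<in> L. T x = T f} - {f}) \<le> 1"
    using finL by simp
  then obtain e1 e2 where e12: "e1 \<in> L" "e2 \<in> L" "T e1 = T f" "T e2 = T f"
      "e1 \<noteq> f" "e2 \<noteq> f" "e1 \<noteq> e2"
    using finL by (auto simp: card_le_Suc0_iff_eq)
  interpret Kf: matroid "K f" using KX(1)[OF f] by (simp add: graphic_def)
  have gK: "ground (K f) = ground M - {f}"
    using KX(2)[OF f] by (simp add: elementary_quotient_def)
  have Lf: "L - {f} \<subseteq> ground M - {f}" using L nonloops_subset by blast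
  have rk12: "rk M {e1, e2} = 2" using rk_nonloop_pair e12 L by blast
  \<comment> \<open>\<open>e1\<close> and \<open>e2\<close> have rank 2 together in
    \<open>M\<close>, so they cannot both be loops of \<open>K f\<close>.\<close>
  have "\<exists>e. e \<in> L \<and> T e = T f \<and> e \<noteq> f \<and> rk (K f) {e} \<noteq> 0"
  proof (rule ccontr)
    assume "\<not> ?thesis"
    then have "rk (K f) {e1} = 0" "rk (K f) {e2} = 0" using e12 by auto
    then have "rk (K f) {e1, e2} = 0"
      using Kf.rk_insert_eq_mono[of "{}" "{e2}" e1] Kf.rk_le_card[of "{}"] by simp
    then show False
      using rk_delete_quotient(2)[OF KX(2)[OF f], of "{e1, e2}"] rk12 e12 Lf by auto
  qed
  then obtain e where e: "e \<in> L" "T e = T f" "e \<noteq> f" "rk (K f) {e} \<noteq> 0" by blast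
  \<comment> \<open>A loop \<open>x\<close> of \<open>K f\<close> would leave the rank of
    \<open>L - {f}\<close> at most 1. Then the rank in \<open>M\<close> would be at most 2, placing
    \<open>x\<close> on the closed line \<open>L\<close>.\<close>
  have nonloop: "rk (K f) {x} \<noteq> 0" if x: "x \<in> nonloops" "x \<notin> L" for x
  proof
    assume "rk (K f) {x} = 0"
    then have "rk (K f) (insert x (L - {f})) = rk (K f) (L - {f})"
      using Kf.rk_insert_eq_mono[of "{}" "L - {f}" x] Kf.rk_le_card[of "{}"] by simp
    moreover have "rk (K f) (L - {f}) \<le> 1"
      using L rkL cardL finL f rk_mono[of "L - {f}" L]
      by (intro long_line_collapses[OF KX(1,2)[OF f]]) auto
    moreover have "insert x (L - {f}) \<subseteq> ground M - {f}"
      using x f Lf nonloops_subset by blast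
    ultimately have "rk M (insert x (L - {f})) \<le> 2"
      using rk_delete_quotient(2)[OF KX(2)[OF f], of "insert x (L - {f})"] by linarith
    then have "insert x (L - {f}) \<subseteq> cl M {e1, e2}"
      using rk12 e12 x L nonloops_subset by (intro subset_cl_if_rk_le) auto
    then have "x \<in> cl M L" using cl_mono[of "{e1, e2}" L] e12 by auto
    then show False using closedL x by blast
  qed
  \<comment> \<open>Obstructions avoid all of \<open>L\<close>, so \<open>X e\<close> avoids
    \<open>f\<close> too, and both sets can be compared in \<open>K f\<close>.\<close>
  have Xf: "X f \<subseteq> ground (K f)" and Xe: "X e \<subseteq> ground (K f)"
    using Xnl[OF f] Xnl[OF e(1)] KX(5)[OF f] KX(5)[OF e(1)] f gK nonloops_subset by auto
  \<comment> \<open>Each \<open>x\<close> in \<open>X e\<close> shares its colour with some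
    \<open>y\<close> in \<open>X f\<close>. If they differ, the colour is a long line through both,
    which collapses in \<open>K f\<close>; there \<open>y\<close> is a nonloop, as it is off
    \<open>L\<close>, and so spans \<open>x\<close>.\<close>
  have "X e \<subseteq> cl (K f) (X f)"
  proof
    fix x assume x: "x \<in> X e"
    then have "c x \<in> T f" using e by (auto simp: T_def)
    then obtain y where y: "y \<in> X f" "c x = c y" by (auto simp: T_def)
    have nl: "x \<in> nonloops" "y \<in> nonloops" "x \<noteq> f" "y \<noteq> f" "y \<notin> L"
      using x y Xnl[OF f] Xnl[OF e(1)] KX(5)[OF f] KX(5)[OF e(1)] f by auto
    show "x \<in> cl (K f) (X f)"
    proof (cases "x = y")
      case True
      then show ?thesis using y Kf.subset_cl[OF Xf] by blast
    next
      case False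
      have cx: "{x, y} \<subseteq> c x" "c x \<subseteq> nonloops" "rk M (c x) \<le> 2" "?h + 1 < card (c x)"
        using c[OF nl(1,2) False y(2)] by auto
      have "?h < card (c x - {f})"
        using cx(4) card_Diff_singleton_if[of "c x" f] by (simp split: if_splits)
      then have "rk (K f) (c x - {f}) \<le> 1"
        using cx rk_mono[of "c x - {f}" "c x"]
        by (intro long_line_collapses[OF KX(1,2)[OF f]]) auto
      then have "c x - {f} \<subseteq> cl (K f) {y}"
        using cx nl nonloop[of y] nonloops_subset gK by (intro Kf.subset_cl_if_rk_le) auto
      then show ?thesis using cx nl y Kf.cl_mono[of "{y}" "X f"] by auto
    qed
  qed
  moreover have "e \<in> cl (K f) (X e)"
  proof -
    have "e \<in> cl (delete M {f}) (X e)"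
      using KX(4)[OF e(1)] e(3) Xe gK by (simp add: cl_delete)
    then show ?thesis
      using KX(2)[OF f] Xe gK unfolding elementary_quotient_def ground_delete by blast
  qed
  ultimately have "e \<in> cl (K f) (X f)" using Kf.cl_subset_cl by blast
  then show False using KX(6)[OF f, of e] e by blast
qed

end

section \<open>From bounded size to finitely many isomorphism classes\<close>

lemma finite_isomorphism_classes_if_bounded:
  fixes \<M> :: "'a::infinite matroid set"
  assumes "\<And>M. M \<in> \<M> \<Longrightarrow> matroid M \<and> card (ground M) \<le> n"
  shows "finite (\<M> // matroid_iso_rel)"
proof -
  obtain U :: "'a set" where U: "finite U" "card U = n"
    using infinite_arbitrarily_large[OF infinite_UNIV] by blast
  \<comment> \<open>Only finitely many records, matroids or not, live inside \<open>U\<close>;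
    relabelling along a bijection puts a representative of every class among them.\<close>
  let ?R = "{M :: 'a matroid. ground M \<subseteq> U \<and> indep M \<subseteq> Pow U}"
  have "?R \<subseteq> (\<lambda>(E, I). \<lparr>ground = E, indep = I\<rparr>) ` (Pow U \<times> Pow (Pow U))"
  proof
    fix M :: "'a matroid" assume "M \<in> ?R"
    then show "M \<in> (\<lambda>(E, I). \<lparr>ground = E, indep = I\<rparr>) ` (Pow U \<times> Pow (Pow U))"
      by (intro image_eqI[of _ _ "(ground M, indep M)"]) auto
  qed
  then have finR: "finite ?R"
    by (rule finite_subset) (use U in auto)
  have "\<M> // matroid_iso_rel \<subseteq> (\<lambda>M. matroid_iso_rel `` {M}) ` ?R"
  proof
    fix Q assume "Q \<in> \<M> // matroid_iso_rel"
    then obtain M where M: "M \<in> \<M>" "Q = matroid_iso_rel `` {M}" by (rule quotientE)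
    interpret matroid M using assms M by blast
    obtain V where V: "V \<subseteq> U" "card V = card (ground M)"
      using obtain_subset_with_card_n[of "card (ground M)" U] assms[OF M(1)] U by auto
    then obtain \<phi> where \<phi>: "bij_betw \<phi> V (ground M)"
      using finite_same_card_bij[of V "ground M"] finite_subset[OF V(1) U(1)] finite_ground by auto
    let ?N = "inverse_image \<phi> V M"
    have "matroid ?N"
      using matroid_inverse_image[OF matroid_axioms] finite_subset[OF V(1) U(1)] by blast
    moreover have "isomorphic ?N M"
      unfolding isomorphic_def using \<phi>
      by (intro exI[of _ \<phi>]) (auto simp: inverse_image_def bij_betw_def intro: inj_on_subset)
    ultimately have "(?N, M) \<in> matroid_iso_rel"
      using matroid_axioms by (simp add: matroid_iso_rel_def)
    then have "Q = matroid_iso_rel `` {?N}"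
      using M equiv_class_eq[OF equiv_matroid_iso_rel] by blast
    moreover have "?N \<in> ?R" using V by (auto simp: inverse_image_def)
    ultimately show "Q \<in> (\<lambda>M. matroid_iso_rel `` {M}) ` ?R" by blast
  qed
  then show ?thesis by (rule finite_subset) (rule finite_imageI[OF finR])
qed

theorem theorem2:
  fixes r :: nat
  assumes "r > 0"
  shows "finite ({M :: 'a::infinite matroid. excluded_minor lifted_graphic M \<and> matroid_rank M = r}
                   // matroid_iso_rel)"
proof -
  define h :: nat where "h = 2 ^ (2 * r)"
  \<comment> \<open>The final \<open>+ 1\<close> allows for a loop.\<close>
  have "matroid M \<and> card (ground M) \<le> (2 * 2 ^ ((h + 2) ^ 2) + h + 1) * (h + 2) ^ 2 + 1"
    if "excluded_minor lifted_graphic M" "matroid_rank M = r" for M :: "'a matroid"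
  proof -
    have "matroid M" using that by (simp add: excluded_minor_def)
    then interpret lifted_graphic_excluded_minor M
      using that by (simp add: lifted_graphic_excluded_minor_def lifted_graphic_excluded_minor_axioms_def)
    have "class_bound = h"
      using that matroid_rank_eq_rk[OF matroid_axioms] by (simp add: class_bound_def h_def)
    then show ?thesis
      using card_nonloops card_nonloops_le \<open>matroid M\<close> by simp
  qed
  then show ?thesis
    by (intro finite_isomorphism_classes_if_bounded) blast
qed

end
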